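(* There exists an absolute constant $c>0$ such that for every centered log-concave probability measure $\mu$ on $\mathbb{R}^n$, $$\|\Lambda_{\mu}^{\ast}\|_{L^2(\mu)}\le c\,n\ln n .$$
   Context: A Borel probability measure $\mu$ on $\mathbb{R}^n$ is called log-concave if $\mu(H)<1$ for every hyperplane $H$ of $\mathbb{R}^n$ and $\mu(\lambda A+(1-\lambda)B)\ge \mu(A)^{\lambda}\mu(B)^{1-\lambda}$ for all compact sets $A,B\subset\mathbb{R}^n$ and all $\lambda\in(0,1)$. It is centered if its barycenter is the origin. The log-Laplace transform is $\Lambda_\mu(\xi)=\ln\left(\int_{\mathbb{R}^n}e^{\langle\xi,z\rangle}\,d\mu(z)\right)$ and the Cramér transform of $\mu$ is its Legendre transform $\Lambda_\mu^\ast(x)=\sup_{\xi\in\mathbb{R}^n}\{\langle x,\xi\rangle-\Lambda_\mu(\xi)\}$. Here $\|h\|_{L^2(\mu)}=\left(\int|h|^2d\mu\right)^{1/2}$. "Absolute constant" means a constant independent of $n$ and $\mu$.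
   Formalization: The dimension is assumed to satisfy n ≥ 2; for n = 1 the bound c n ln n equals 0 and the claim fails, e.g. for the uniform measure on [-1,1]. *)

theory Defs
  imports "HOL-Probability.Probability"
begin

text \<open>
  The dimension has to be quantified inside the formula (the constant is uniform in it), so
  \<open>\<real>\<^sup>n\<close> is the set of functions \<open>nat \<Rightarrow> real\<close> that are extensional on \<open>{..<n}\<close>, i.e. the space
  of the finite product measures. The product topology below is the usual topology, and the
  product \<open>\<sigma>\<close>-algebra is its Borel \<open>\<sigma>\<close>-algebra.
\<close>

abbreviation Rn :: "nat \<Rightarrow> (nat \<Rightarrow> real) set" where
  "Rn n \<equiv> {..<n} \<rightarrow>\<^sub>E UNIV"

abbreviation Rn_borel :: "nat \<Rightarrow> (nat \<Rightarrow> real) measure" where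
  "Rn_borel n \<equiv> \<Pi>\<^sub>M i\<in>{..<n}. borel"

abbreviation Rn_top :: "nat \<Rightarrow> (nat \<Rightarrow> real) topology" where
  "Rn_top n \<equiv> product_topology (\<lambda>_. euclideanreal) {..<n}"

definition Rn_inner :: "nat \<Rightarrow> (nat \<Rightarrow> real) \<Rightarrow> (nat \<Rightarrow> real) \<Rightarrow> real" where
  "Rn_inner n x y = (\<Sum>i<n. x i * y i)"

text \<open>Affine hyperplanes, not necessarily through the origin.\<close>

definition Rn_hyperplane :: "nat \<Rightarrow> (nat \<Rightarrow> real) set \<Rightarrow> bool" where
  "Rn_hyperplane n H \<longleftrightarrow>
     (\<exists>u\<in>Rn n. \<exists>t. (\<exists>i<n. u i \<noteq> 0) \<and> H = {x \<in> Rn n. Rn_inner n u x = t})"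

definition Rn_mix ::
    "nat \<Rightarrow> real \<Rightarrow> (nat \<Rightarrow> real) set \<Rightarrow> (nat \<Rightarrow> real) set \<Rightarrow> (nat \<Rightarrow> real) set" where
  "Rn_mix n l A B = {\<lambda>i\<in>{..<n}. l * a i + (1 - l) * b i | a b. a \<in> A \<and> b \<in> B}"

definition borel_prob :: "nat \<Rightarrow> (nat \<Rightarrow> real) measure \<Rightarrow> bool" where
  "borel_prob n \<mu> \<longleftrightarrow> prob_space \<mu> \<and> sets \<mu> = sets (Rn_borel n)"

definition log_concave_measure :: "nat \<Rightarrow> (nat \<Rightarrow> real) measure \<Rightarrow> bool" where
  "log_concave_measure n \<mu> \<longleftrightarrow>
     (\<forall>H. Rn_hyperplane n H \<longrightarrow> measure \<mu> H < 1) \<and>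
     (\<forall>A B l. compactin (Rn_top n) A \<longrightarrow> compactin (Rn_top n) B \<longrightarrow> 0 < l \<longrightarrow> l < 1 \<longrightarrow>
        measure \<mu> (Rn_mix n l A B) \<ge> measure \<mu> A powr l * measure \<mu> B powr (1 - l))"

text \<open>\<open>has_bochner_integral\<close> rather than \<open>lebesgue_integral\<close>: the barycenter has to exist.\<close>

definition centered_measure :: "nat \<Rightarrow> (nat \<Rightarrow> real) measure \<Rightarrow> bool" where
  "centered_measure n \<mu> \<longleftrightarrow> (\<forall>i<n. has_bochner_integral \<mu> (\<lambda>x. x i) 0)"

text \<open>The logarithm and the square root on \<open>[0,\<infinity>]\<close>.\<close>

definition ennreal_ln :: "ennreal \<Rightarrow> ereal" where
  "ennreal_ln a = (if a = 0 then - \<infinity> else if a = top then \<infinity> else ereal (ln (enn2real a)))"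

definition ennreal_sqrt :: "ennreal \<Rightarrow> ennreal" where
  "ennreal_sqrt a = (if a = top then top else ennreal (sqrt (enn2real a)))"

text \<open>Both transforms may take the value \<open>\<infinity>\<close>.\<close>

definition log_laplace :: "nat \<Rightarrow> (nat \<Rightarrow> real) measure \<Rightarrow> (nat \<Rightarrow> real) \<Rightarrow> ereal" where
  "log_laplace n \<mu> \<xi> = ennreal_ln (\<integral>\<^sup>+ z. ennreal (exp (Rn_inner n \<xi> z)) \<partial>\<mu>)"

definition cramer_transform :: "nat \<Rightarrow> (nat \<Rightarrow> real) measure \<Rightarrow> (nat \<Rightarrow> real) \<Rightarrow> ereal" where
  "cramer_transform n \<mu> x = (SUP \<xi>\<in>Rn n. ereal (Rn_inner n x \<xi>) - log_laplace n \<mu> \<xi>)"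

definition L2_norm_ereal :: "'a measure \<Rightarrow> ('a \<Rightarrow> ereal) \<Rightarrow> ennreal" where
  "L2_norm_ereal \<mu> h = ennreal_sqrt (\<integral>\<^sup>+ x. (e2ennreal \<bar>h x\<bar>)\<^sup>2 \<partial>\<mu>)"

end

theory Submission
  imports Defs
begin

text \<open>
  By Markov's inequality, \<open>\<Lambda>\<^sup>*(x) \<le> - ln \<kappa>\<close> as soon as every half-space with \<open>x\<close> on its boundary has
  measure at least \<open>\<kappa>\<close>. To bound this depth from below, use coordinates that are orthonormal in
  \<open>L\<^sup>2(\<mu>)\<close>; log-concavity of half-space measures gives \<open>\<mu>(\<langle>c, \<cdot>\<rangle> \<ge> \<bar>c\<bar> / 128) \<ge> 1 / 8\<close> for every \<open>c\<close>.
  Call a point heavy if a small cube around it has measure at least \<open>\<theta>\<close>. Heavy points form a convex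
  set; it contains all but a small part of a grid, hence also a point \<open>p\<close> near the barycenter. If \<open>q\<close> is
  heavy and \<open>b\<close> is close to \<open>p\<close>, then every half-space with \<open>x = (1 - \<epsilon>) q + \<epsilon> b\<close> on its boundary
  contains the corresponding mixture of a cube around \<open>q\<close> and a half-space of measure at least
  \<open>1 / 8\<close>, so \<open>x\<close> has depth at least \<open>\<theta> / 8\<close>. Log-concavity also shows that such \<open>x\<close> fill all
  but a fraction of order \<open>\<epsilon> n ln (n / \<epsilon>)\<close> of the measure. Since \<open>ln (1 / \<theta>)\<close> is of order
  \<open>n ln (n / \<epsilon>)\<close>, taking \<open>\<epsilon> = 2\<^sup>-\<^sup>j / (16 n\<^sup>2)\<close> and summing over \<open>j\<close> bounds the second moment.
\<close>

section \<open>Closed sets and half-spaces\<close>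

lemma continuous_map_Rn_inner: "continuous_map (Rn_top n) euclideanreal (Rn_inner n u)"
  unfolding Rn_inner_def
  by (intro continuous_map_sum continuous_map_real_mult continuous_map_product_projection) auto

text \<open>On the full function space over \<open>nat\<close> the product sigma-algebra is the
  Borel one. \<open>A\<close> is pulled back there along restriction to \<open>{..<n}\<close>;
  pulling back once more along extension by zero (\<open>e\<close>) returns \<open>A\<close>,
  because restricting after extending is the identity on \<open>Rn n\<close>.\<close>

lemma closedin_Rn_imp_sets:
  assumes "closedin (Rn_top n) A"
  shows "A \<in> sets (Rn_borel n)"
proof -
  define e :: "(nat \<Rightarrow> real) \<Rightarrow> nat \<Rightarrow> real" where "e = (\<lambda>x i. if i < n then x i else 0)"
  have cont: "continuous_map euclidean (Rn_top n) (\<lambda>x. restrict x {..<n})"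
    by (auto simp: continuous_map_componentwise intro!: continuous_on_product_coordinates)
  have "closed {x. restrict x {..<n} \<in> A}"
    using closedin_continuous_map_preimage[OF cont assms] by simp
  hence "{x. restrict x {..<n} \<in> A} \<in> sets (\<Pi>\<^sub>M i\<in>UNIV. (borel :: real measure))"
    unfolding sets_PiM_equal_borel by (rule borel_closed)
  moreover have "e \<in> Rn_borel n \<rightarrow>\<^sub>M (\<Pi>\<^sub>M i\<in>UNIV. (borel :: real measure))"
    unfolding e_def
  proof (rule measurable_PiM_single')
    show "(\<lambda>\<omega>. if i < n then \<omega> i else 0) \<in> borel_measurable (Rn_borel n)" for i
      by (cases "i < n") auto
  qed auto
  ultimately have "e -` {x. restrict x {..<n} \<in> A} \<inter> space (Rn_borel n) \<in> sets (Rn_borel n)"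
    by (rule measurable_sets[rotated])
  moreover have "restrict (e z) {..<n} = z" if "z \<in> Rn n" for z
    using that by (auto simp: e_def fun_eq_iff PiE_def extensional_def)
  then have "e -` {x. restrict x {..<n} \<in> A} \<inter> space (Rn_borel n) = A"
    using closedin_subset[OF assms] by (auto simp: space_PiM)
  ultimately show ?thesis by simp
qed

lemma Rn_mix_mono: "A \<subseteq> A' \<Longrightarrow> B \<subseteq> B' \<Longrightarrow> Rn_mix n l A B \<subseteq> Rn_mix n l A' B'"
  unfolding Rn_mix_def by blast

lemma Rn_inner_mix:
  "Rn_inner n u (\<lambda>i\<in>{..<n}. l * a i + (1 - l) * b i) = l * Rn_inner n u a + (1 - l) * Rn_inner n u b"
  by (simp add: Rn_inner_def sum.distrib[symmetric] sum_distrib_left algebra_simps)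

locale log_concave_prob = prob_space \<mu> for \<mu> :: "(nat \<Rightarrow> real) measure" +
  fixes n :: nat
  assumes sets_eq: "sets \<mu> = sets (Rn_borel n)"
    and lc: "log_concave_measure n \<mu>"
begin

lemma space_eq: "space \<mu> = Rn n"
  using sets_eq_imp_space_eq[OF sets_eq] by (simp add: space_PiM)

lemma closedin_sets: "closedin (Rn_top n) A \<Longrightarrow> A \<in> sets \<mu>"
  using closedin_Rn_imp_sets sets_eq by simp

lemma measurable_Rn_inner [measurable]: "Rn_inner n u \<in> borel_measurable \<mu>"
proof -
  have "Rn_inner n u \<in> borel_measurable (Rn_borel n)"
    unfolding Rn_inner_def by measurable
  then show ?thesis
    by (simp cong: measurable_cong_sets add: measurable_cong_sets[OF sets_eq])
qed

text \<open>Bounding by a measurable superset \<open>C\<close> spares every later argument from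
  describing the mixture exactly or discussing its measurability.\<close>

lemma prob_ge_of_compactin:
  assumes A: "compactin (Rn_top n) A" and B: "compactin (Rn_top n) B"
    and C: "C \<in> sets \<mu>" "Rn_mix n l A B \<subseteq> C" and l: "0 < l" "l < 1"
  shows "prob A powr l * prob B powr (1 - l) \<le> prob C"
proof -
  have "prob A powr l * prob B powr (1 - l) \<le> prob (Rn_mix n l A B)"
    using lc A B l unfolding log_concave_measure_def by blast
  also have "\<dots> \<le> prob C"
    using C by (rule finite_measure_mono[rotated])
  finally show ?thesis .
qed

text \<open>Half-spaces are closed but unbounded, so the inequality has to leave the compact sets.
  Both sets are exhausted by the boxes \<open>K k\<close>, and continuity of the measure from below
  passes to the limit.\<close>

lemma prob_ge_of_closedin:
  assumes A: "closedin (Rn_top n) A" and B: "closedin (Rn_top n) B"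
    and C: "C \<in> sets \<mu>" "Rn_mix n l A B \<subseteq> C" and l: "0 < l" "l < 1"
  shows "prob A powr l * prob B powr (1 - l) \<le> prob C"
proof -
  define K where "K k = PiE {..<n} (\<lambda>_. {- real k..real k})" for k
  have K: "compactin (Rn_top n) (K k)" for k
    unfolding K_def by (subst compactin_PiE) auto
  have lim: "(\<lambda>k. prob (D \<inter> K k)) \<longlonglongrightarrow> prob D" if D: "closedin (Rn_top n) D" for D
  proof -
    have "compactin (Rn_top n) (D \<inter> K k)" for k
      using D K closed_Int_compactin by blast
    moreover have "Hausdorff_space (Rn_top n)"
      by (simp add: Hausdorff_space_product_topology)
    ultimately have "D \<inter> K k \<in> events" for k
      using compactin_imp_closedin closedin_sets by blast
    moreover have "incseq (\<lambda>k. D \<inter> K k)"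
    proof -
      have "K j \<subseteq> K k" if "j \<le> k" for j k
        unfolding K_def using that by (intro PiE_mono) auto
      then show ?thesis
        unfolding incseq_def by blast
    qed
    moreover have "(\<Union>k. D \<inter> K k) = D"
    proof -
      have "\<exists>k. x \<in> K k" if "x \<in> D" for x
      proof -
        obtain k where "(\<Sum>i<n. \<bar>x i\<bar>) \<le> real k"
          using real_arch_simple by blast
        moreover have "\<bar>x i\<bar> \<le> (\<Sum>i<n. \<bar>x i\<bar>)" if "i < n" for i
          using that by (intro member_le_sum) auto
        moreover have "x \<in> Rn n"
          using \<open>x \<in> D\<close> closedin_subset[OF D] by auto
        ultimately have "x \<in> K k"
          unfolding K_def by (force simp: PiE_iff abs_le_iff)
        then show ?thesis ..
      qed
      then show ?thesis by blast
    qed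
    ultimately show ?thesis
      using finite_Lim_measure_incseq[of "\<lambda>k. D \<inter> K k"] by auto
  qed
  have "prob (A \<inter> K k) powr l * prob (B \<inter> K k) powr (1 - l) \<le> prob C" for k
  proof (rule prob_ge_of_compactin)
    show "compactin (Rn_top n) (A \<inter> K k)" "compactin (Rn_top n) (B \<inter> K k)"
      using A B K closed_Int_compactin by blast+
    show "Rn_mix n l (A \<inter> K k) (B \<inter> K k) \<subseteq> C"
      using C(2) Rn_mix_mono[of "A \<inter> K k" A "B \<inter> K k" B n l] by auto
  qed (use C l in auto)
  moreover have "(\<lambda>k. prob (A \<inter> K k) powr l * prob (B \<inter> K k) powr (1 - l))
      \<longlonglongrightarrow> prob A powr l * prob B powr (1 - l)"
    \<comment> \<open>Both exponents are positive, so \<open>powr\<close> stays continuous even when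
      a limiting measure is 0.\<close>
    using l by (intro tendsto_mult tendsto_powr' lim A B tendsto_const) auto
  ultimately show ?thesis
    using LIMSEQ_le_const2 by blast
qed

end

section \<open>Log-concave random variables\<close>

text \<open>Log-concavity is required of upper tails only. For linear functionals the lower tails
  are reached by passing from \<open>u\<close> to \<open>-u\<close>.\<close>

locale log_concave_variable = prob_space M for M :: "'a measure" +
  fixes X :: "'a \<Rightarrow> real"
  assumes X_measurable [measurable]: "X \<in> borel_measurable M"
    and tail_log_concave: "\<And>l s t. 0 < l \<Longrightarrow> l < 1 \<Longrightarrow>
      \<P>(x in M. s \<le> X x) powr l * \<P>(x in M. t \<le> X x) powr (1 - l) \<le> \<P>(x in M. l * s + (1 - l) * t \<le> X x)"
begin

text \<open>The level \<open>s\<close> divides the segment from \<open>s - d\<close> to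
  \<open>s + j * d\<close> with weights j/(j+1) and 1/(j+1). Log-concavity therefore gives T(s-d)^j
  * T(s+jd) \<le> T(s)^(j+1) for the tail function T, which is geometric decay as soon as p <
  q.\<close>

lemma tail_decay:
  assumes p: "\<P>(x in M. s \<le> X x) \<le> p" and q: "q \<le> \<P>(x in M. s - d \<le> X x)" "0 < q"
  shows "\<P>(x in M. s + real j * d \<le> X x) \<le> p * (p / q) ^ j"
proof (cases "j = 0")
  case True
  then show ?thesis using p by simp
next
  case False
  define T where "T s = \<P>(x in M. s \<le> X x)" for s
  define l where "l = real j / (real j + 1)"
  have l: "0 < l" "l < 1" "1 - l = 1 / (real j + 1)"
    using False by (auto simp: l_def field_simps)
  have T0: "0 \<le> T s" for s
    by (simp add: T_def)
  have "l * (s - d) + (1 - l) * (s + real j * d) = s"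
    unfolding l(3) unfolding l_def by (simp add: divide_simps) (simp add: algebra_simps)
  then have "T (s - d) powr l * T (s + real j * d) powr (1 - l) \<le> T s"
    using tail_log_concave[OF l(1,2), of "s - d" "s + real j * d"] by (simp add: T_def)
  \<comment> \<open>The power \<open>Suc j\<close> clears the denominators of both
    exponents.\<close>
  then have "(T (s - d) powr l * T (s + real j * d) powr (1 - l)) ^ Suc j \<le> T s ^ Suc j"
    by (intro power_mono) auto
  also have "(T (s - d) powr l * T (s + real j * d) powr (1 - l)) ^ Suc j
      = T (s - d) ^ j * T (s + real j * d)"
  proof -
    have "(T (s - d) powr l) ^ Suc j = T (s - d) ^ j"
    proof -
      have pos: "0 < T (s - d)" using q by (simp add: T_def)
      have "(T (s - d) powr l) ^ Suc j = T (s - d) powr (l * real (Suc j))"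
        using pos by (subst powr_realpow[symmetric]) (simp_all only: powr_powr, simp)
      also have "l * real (Suc j) = real j" by (simp add: l_def field_simps)
      finally show ?thesis using pos by (simp add: powr_realpow)
    qed
    \<comment> \<open>The far tail may vanish, and \<open>powr_realpow\<close> needs a positive
      base, so that case is separated.\<close>
    moreover have "(T (s + real j * d) powr (1 - l)) ^ Suc j = T (s + real j * d)"
    proof (cases "T (s + real j * d) = 0")
      case False
      then have pos: "0 < T (s + real j * d)" using T0[of "s + real j * d"] by linarith
      have "(T (s + real j * d) powr (1 - l)) ^ Suc j = T (s + real j * d) powr ((1 - l) * real (Suc j))"
        using pos by (subst powr_realpow[symmetric]) (simp_all only: powr_powr, simp)
      also have "(1 - l) * real (Suc j) = 1" unfolding l(3) by (simp add: field_simps)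
      finally show ?thesis using pos by simp
    qed simp
    ultimately show ?thesis by (simp only: power_mult_distrib)
  qed
  finally have 1: "T (s - d) ^ j * T (s + real j * d) \<le> T s ^ Suc j" .
  have "q ^ j * T (s + real j * d) \<le> T (s - d) ^ j * T (s + real j * d)"
    using q T0 by (intro mult_right_mono power_mono) (auto simp: T_def)
  also note 1
  also have "T s ^ Suc j \<le> p ^ Suc j"
    using p T0 by (intro power_mono) (auto simp: T_def)
  finally show ?thesis
    using q by (simp add: T_def field_simps power_divide)
qed

end

section \<open>Elementary tail bounds and a discrete layer-cake formula\<close>

lemma (in prob_space) prob_ge_eq_one_minus:
  assumes [measurable]: "X \<in> borel_measurable M"
  shows "\<P>(x in M. s \<le> X x) = 1 - \<P>(x in M. X x < (s :: real))"
proof -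
  have "{x \<in> space M. s \<le> X x} = space M - {x \<in> space M. X x < s}" by auto
  then show ?thesis by (simp add: prob_compl)
qed

lemma (in prob_space) markov_abs:
  fixes X :: "'a \<Rightarrow> real"
  assumes X: "integrable M X" and s: "0 < s"
  shows "\<P>(x in M. s \<le> \<bar>X x\<bar>) \<le> expectation (\<lambda>x. \<bar>X x\<bar>) / s"
  using integral_Markov_inequality_measure[of M "\<lambda>x. \<bar>X x\<bar>" "{}" s] X s by auto

text \<open>A value \<open>x\<close> in the \<open>k\<close>-th interval of length \<open>d\<close>
  above \<open>s\<close> switches on all indicators with index j \<le> k, so the series dominates
  the partial sum allowed by \<open>far\<close>. The \<open>g j\<close> may thus be increments of a
  function or bounds for its whole value.\<close>

lemma le_sum_steps:
  fixes x s d :: real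
  assumes d: "0 < d" and g: "\<And>j. 0 \<le> g j" and "0 \<le> s'"
    and near: "x < s \<Longrightarrow> f \<le> s'"
    and far: "\<And>k. s + real k * d \<le> x \<Longrightarrow> x < s + real (Suc k) * d \<Longrightarrow> f \<le> s' + (\<Sum>j\<le>k. g j)"
  shows "ennreal f \<le> ennreal s' + (\<Sum>j. ennreal (g j) * indicator {y. s + real j * d \<le> y} x)"
proof (cases "x < s")
  case True
  then have "ennreal f \<le> ennreal s' + 0"
    using near by (simp add: ennreal_leI)
  also have "\<dots> \<le> ennreal s' + (\<Sum>j. ennreal (g j) * indicator {y. s + real j * d \<le> y} x)"
    by (intro add_left_mono) simp
  finally show ?thesis .
next
  case False
  define k where "k = nat \<lfloor>(x - s) / d\<rfloor>"
  have nn: "0 \<le> (x - s) / d" using False d by auto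
  then have k: "real k = of_int \<lfloor>(x - s) / d\<rfloor>" by (simp add: k_def)
  have "real k \<le> (x - s) / d" "(x - s) / d < real k + 1"
    unfolding k by linarith+
  then have kk: "s + real k * d \<le> x" "x < s + real (Suc k) * d"
    using d by (auto simp: field_simps)
  have ind: "indicator {y. s + real j * d \<le> y} x = (1 :: ennreal)" if "j \<le> k" for j
  proof -
    have "real j * d \<le> real k * d" using that d by (intro mult_right_mono) auto
    then show ?thesis using kk by (simp add: indicator_def)
  qed
  have "ennreal f \<le> ennreal (s' + (\<Sum>j\<le>k. g j))"
    using far[OF kk] by (intro ennreal_leI)
  also have "\<dots> = ennreal s' + (\<Sum>j\<le>k. ennreal (g j))"
    using g \<open>0 \<le> s'\<close> by (subst ennreal_plus) (auto intro: sum_nonneg)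
  also have "(\<Sum>j\<le>k. ennreal (g j)) = (\<Sum>j\<le>k. ennreal (g j) * indicator {y. s + real j * d \<le> y} x)"
    by (intro sum.cong) (auto simp: ind)
  also have "\<dots> \<le> (\<Sum>j. ennreal (g j) * indicator {y. s + real j * d \<le> y} x)"
    by (rule sum_le_suminf) auto
  finally show ?thesis by (simp add: add_left_mono)
qed

text \<open>Integrating the series of \<open>le_sum_steps\<close> term by term turns indicators into
  tail probabilities, which \<open>tail_decay\<close> controls.\<close>

lemma (in prob_space) nn_integral_steps_le:
  fixes X :: "'a \<Rightarrow> real"
  assumes [measurable]: "X \<in> borel_measurable M"
    and h: "\<And>x. x \<in> space M \<Longrightarrow>
      h x \<le> ennreal s' + (\<Sum>j. ennreal (g j) * indicator {y. s + real j * d \<le> y} (X x))"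
    and g: "\<And>j. 0 \<le> g j" "0 \<le> s'"
    and b: "\<And>j. g j * \<P>(x in M. s + real j * d \<le> X x) \<le> b j" "b sums B"
  shows "(\<integral>\<^sup>+x. h x \<partial>M) \<le> ennreal (s' + B)"
proof -
  have b0: "0 \<le> b j" for j
    using order_trans[OF _ b(1)[of j]] g(1)[of j] by (simp add: measure_nonneg)
  have "(\<integral>\<^sup>+x. h x \<partial>M)
      \<le> (\<integral>\<^sup>+x. ennreal s' + (\<Sum>j. ennreal (g j) * indicator {y. s + real j * d \<le> y} (X x)) \<partial>M)"
    by (intro nn_integral_mono h) auto
  also have "\<dots> = ennreal s' + (\<Sum>j. \<integral>\<^sup>+x. ennreal (g j) * indicator {y. s + real j * d \<le> y} (X x) \<partial>M)"
    by (subst nn_integral_add, simp, measurable, subst nn_integral_suminf, measurable) (simp add: emeasure_space_1)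
  also have "(\<lambda>j. \<integral>\<^sup>+x. ennreal (g j) * indicator {y. s + real j * d \<le> y} (X x) \<partial>M)
      = (\<lambda>j. ennreal (g j * \<P>(x in M. s + real j * d \<le> X x)))"
  proof
    fix j
    have "(\<integral>\<^sup>+x. ennreal (g j) * indicator {y. s + real j * d \<le> y} (X x) \<partial>M)
        = (\<integral>\<^sup>+x. ennreal (g j) * indicator {x \<in> space M. s + real j * d \<le> X x} x \<partial>M)"
      by (intro nn_integral_cong) (auto simp: indicator_def)
    also have "\<dots> = ennreal (g j) * emeasure M {x \<in> space M. s + real j * d \<le> X x}"
      by (subst nn_integral_cmult_indicator) auto
    finally show "(\<integral>\<^sup>+x. ennreal (g j) * indicator {y. s + real j * d \<le> y} (X x) \<partial>M)
        = ennreal (g j * \<P>(x in M. s + real j * d \<le> X x))"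
      using g by (simp add: emeasure_eq_measure ennreal_mult)
  qed
  also have "(\<Sum>j. ennreal (g j * \<P>(x in M. s + real j * d \<le> X x))) \<le> (\<Sum>j. ennreal (b j))"
    by (intro suminf_le ennreal_leI b) auto
  also have "\<dots> = ennreal B"
    using b b0 by (metis suminf_ennreal2 sums_summable sums_unique)
  finally show ?thesis
    using b0 b(2) g(2) by (subst ennreal_plus) (auto intro: sums_le[OF _ sums_zero] simp: add_left_mono)
qed

section \<open>First and second moments of log-concave variables\<close>

context log_concave_variable
begin

lemma prob_ge_quarter_abs_moment:
  assumes X: "integrable M X" "expectation X = 0"
    and m: "m = expectation (\<lambda>x. \<bar>X x\<bar>)" "0 < m"
  shows "1 / 8 \<le> \<P>(x in M. m / 4 \<le> X x)"
proof (rule ccontr)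
  assume "\<not> ?thesis"
  \<comment> \<open>Otherwise the tail beyond \<open>m / 4\<close> is geometric and too light for \<open>E X\<^sup>+ = m / 2\<close>.\<close>
  then have p: "\<P>(x in M. m / 4 \<le> X x) \<le> 1 / 8" by simp
  have int_abs: "integrable M (\<lambda>x. \<bar>X x\<bar>)" using X(1) by simp
  have pos: "expectation (\<lambda>x. max 0 (X x)) = m / 2"
  proof -
    have "expectation (\<lambda>x. max 0 (X x)) = expectation (\<lambda>x. (X x + \<bar>X x\<bar>) / 2)"
      by (intro Bochner_Integration.integral_cong) auto
    then show ?thesis using X int_abs m by simp
  qed
  have neg: "expectation (\<lambda>x. max 0 (- X x)) = m / 2"
  proof -
    have "expectation (\<lambda>x. max 0 (- X x)) = expectation (\<lambda>x. (\<bar>X x\<bar> - X x) / 2)"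
      by (intro Bochner_Integration.integral_cong) auto
    then show ?thesis using X int_abs m by simp
  qed
  \<comment> \<open>Markov for the negative part, whose mean is m/2, leaves mass at least 1/2 above
    -m = m/4 - 5m/4. So the decay step is 5m/4 and the ratio is (1/8)/(1/2) = 1/4.\<close>
  have "\<P>(x in M. X x < - m) \<le> \<P>(x in M. m \<le> max 0 (- X x))"
    by (intro finite_measure_mono) auto
  also have "\<dots> \<le> (m / 2) / m"
    using integral_Markov_inequality_measure[of M "\<lambda>x. max 0 (- X x)" "{}" m] X m neg by auto
  finally have q: "1 / 2 \<le> \<P>(x in M. m / 4 - 5 * m / 4 \<le> X x)"
    using m by (subst prob_ge_eq_one_minus) auto
  define d where "d = 5 * m / 4"
  have d: "0 < d" using m by (simp add: d_def)
  have tail: "d * \<P>(x in M. m / 4 + real j * d \<le> X x) \<le> d / 8 * (1 / 4) ^ j" for j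
    using tail_decay[OF p q, of j] d by (simp add: d_def)
  \<comment> \<open>The bound equals m/4 + 5m/24 = 11m/24, which is less than m/2.\<close>
  have "(\<integral>\<^sup>+x. ennreal (max 0 (X x)) \<partial>M) \<le> ennreal (m / 4 + d / 8 * (1 / (1 - 1 / 4)))"
  proof (rule nn_integral_steps_le[where X = X and s = "m / 4" and d = d and g = "\<lambda>_. d"])
    show "(\<lambda>j. d / 8 * (1 / 4) ^ j) sums (d / 8 * (1 / (1 - 1 / 4)))"
      by (intro sums_mult geometric_sums) auto
    show "ennreal (max 0 (X x)) \<le> ennreal (m / 4) + (\<Sum>j. ennreal d * indicator {y. m / 4 + real j * d \<le> y} (X x))" for x
      using m d by (intro le_sum_steps) (auto simp: algebra_simps)
  qed (use tail d m in auto)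
  moreover have "(\<integral>\<^sup>+x. ennreal (max 0 (X x)) \<partial>M) = ennreal (m / 2)"
    using X pos by (subst nn_integral_eq_integral) auto
  ultimately have "ennreal (m / 2) \<le> ennreal (m / 4 + d / 8 * (1 / (1 - 1 / 4)))"
    by simp
  then have "m / 2 \<le> m / 4 + d / 8 * (1 / (1 - 1 / 4))"
    using m(2) d by (subst (asm) ennreal_le_iff) auto
  then show False using m by (simp add: d_def)
qed

text \<open>A reverse Hoelder inequality. Markov for |X| at 4m leaves at most 1/4 of the mass above
  4m and at least 3/4 above -4m, so the tail bound falls by a factor 3 with every step of length 8m,
  faster than the squares grow.\<close>

lemma nn_integral_pos_part_sq_le:
  assumes X: "integrable M X"
    and m: "m = expectation (\<lambda>x. \<bar>X x\<bar>)" "0 < m"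
  shows "(\<integral>\<^sup>+x. ennreal ((max 0 (X x))\<^sup>2) \<partial>M) \<le> ennreal (512 * m\<^sup>2)"
proof -
  have mk: "\<P>(x in M. 4 * m \<le> \<bar>X x\<bar>) \<le> 1 / 4"
    using markov_abs[OF X, of "4 * m"] m by simp
  have p: "\<P>(x in M. 4 * m \<le> X x) \<le> 1 / 4"
    by (rule order_trans[OF finite_measure_mono mk]) auto
  have "\<P>(x in M. X x < - (4 * m)) \<le> 1 / 4"
    by (rule order_trans[OF finite_measure_mono mk]) auto
  then have q: "3 / 4 \<le> \<P>(x in M. 4 * m - 8 * m \<le> X x)"
    by (subst prob_ge_eq_one_minus) auto
  \<comment> \<open>On the j-th step X < (12 + 8j)m. Bernoulli's inequality replaces this linear
    growth by 12m(5/3)^j, whose square loses against (1/3)^j: (25/9)/3 = 25/27 < 1.\<close>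
  define g where "g j = (12 * m * (5 / 3) ^ j)\<^sup>2" for j :: nat
  have g: "((12 + 8 * real j) * m)\<^sup>2 \<le> g j" for j
  proof -
    have "1 + real j * (2 / 3) \<le> (1 + 2 / 3) ^ j"
      by (rule Bernoulli_inequality) simp
    then have "(12 + 8 * real j) * m \<le> 12 * (5 / 3) ^ j * m"
      using m by (intro mult_right_mono) auto
    then show ?thesis
      unfolding g_def using m by (intro power_mono) (auto simp: mult_ac)
  qed
  \<comment> \<open>The total is 16 + 36 * 27/2 = 502 times m^2, rounded up to 512 so that two
    copies give (32m)^2.\<close>
  have "(\<integral>\<^sup>+x. ennreal ((max 0 (X x))\<^sup>2) \<partial>M) \<le> ennreal (16 * m\<^sup>2 + 36 * m\<^sup>2 * (1 / (1 - 25 / 27)))"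
  proof (rule nn_integral_steps_le[where X = X and s = "4 * m" and d = "8 * m" and g = g])
    show "(\<lambda>j. 36 * m\<^sup>2 * (25 / 27) ^ j) sums (36 * m\<^sup>2 * (1 / (1 - 25 / 27)))"
      by (intro sums_mult geometric_sums) auto
    show "g j * \<P>(x in M. 4 * m + real j * (8 * m) \<le> X x) \<le> 36 * m\<^sup>2 * (25 / 27) ^ j" for j
    proof -
      have "g j * \<P>(x in M. 4 * m + real j * (8 * m) \<le> X x) \<le> g j * (1 / 4 * ((1 / 4) / (3 / 4)) ^ j)"
        using tail_decay[OF p q, of j] by (intro mult_left_mono) (auto simp: g_def)
      also have "\<dots> = 36 * m\<^sup>2 * (((5 / 3)\<^sup>2) ^ j * (1 / 3) ^ j)"
        by (simp add: g_def power_mult_distrib power_commutes flip: power_mult)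
      also have "\<dots> = 36 * m\<^sup>2 * (25 / 27) ^ j"
        by (simp add: power2_eq_square flip: power_mult_distrib)
      finally show ?thesis .
    qed
    show "ennreal ((max 0 (X x))\<^sup>2)
        \<le> ennreal (16 * m\<^sup>2) + (\<Sum>j. ennreal (g j) * indicator {y. 4 * m + real j * (8 * m) \<le> y} (X x))" for x
    proof (rule le_sum_steps)
      assume "X x < 4 * m"
      then have "(max 0 (X x))\<^sup>2 \<le> (4 * m)\<^sup>2" using m by (intro power_mono) auto
      then show "(max 0 (X x))\<^sup>2 \<le> 16 * m\<^sup>2" by (simp add: power_mult_distrib)
    next
      fix k assume k: "4 * m + real k * (8 * m) \<le> X x" "X x < 4 * m + real (Suc k) * (8 * m)"
      have "(max 0 (X x))\<^sup>2 \<le> ((12 + 8 * real k) * m)\<^sup>2"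
        using k m by (intro power_mono) (auto simp: algebra_simps)
      also have "\<dots> \<le> g k" by (rule g)
      also have "\<dots> \<le> (\<Sum>j\<le>k. g j)"
        by (rule member_le_sum) (auto simp: g_def)
      finally show "(max 0 (X x))\<^sup>2 \<le> 16 * m\<^sup>2 + (\<Sum>j\<le>k. g j)"
        by (simp add: add_increasing)
    qed (use m in \<open>auto simp: g_def\<close>)
  qed (auto simp: g_def)
  also have "\<dots> \<le> ennreal (512 * m\<^sup>2)"
    by (intro ennreal_leI) simp
  finally show ?thesis .
qed

end

section \<open>Orthonormal linear functionals\<close>

lemma Rn_inner_sum_left:
  "Rn_inner n (\<lambda>k. \<Sum>i\<in>I. c i * u i k) z = (\<Sum>i\<in>I. c i * Rn_inner n (u i) z)"
proof -
  have "Rn_inner n (\<lambda>k. \<Sum>i\<in>I. c i * u i k) z = (\<Sum>k<n. \<Sum>i\<in>I. c i * u i k * z k)"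
    by (simp add: Rn_inner_def sum_distrib_right)
  also have "\<dots> = (\<Sum>i\<in>I. \<Sum>k<n. c i * u i k * z k)"
    by (rule sum.swap)
  finally show ?thesis
    by (simp add: Rn_inner_def sum_distrib_left mult_ac)
qed

lemma Rn_inner_diff_left: "Rn_inner n (\<lambda>k. u k - v k) z = Rn_inner n u z - Rn_inner n v z"
  by (simp add: Rn_inner_def sum_subtractf left_diff_distrib)

lemma Rn_inner_scale_left: "Rn_inner n (\<lambda>k. u k / s) z = Rn_inner n u z / s"
  by (simp add: Rn_inner_def sum_divide_distrib)

lemma Rn_inner_minus_left: "Rn_inner n (\<lambda>k. - u k) z = - Rn_inner n u z"
  by (simp add: Rn_inner_def sum_negf)

lemma Rn_inner_axis: "j < n \<Longrightarrow> Rn_inner n (\<lambda>k. of_bool (k = j)) z = z j"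
proof -
  assume "j < n"
  moreover have "(\<Sum>k<n. of_bool (k = j) * z k) = (\<Sum>k<n. if k = j then z k else 0)"
    by (intro sum.cong) auto
  ultimately show ?thesis by (simp add: Rn_inner_def)
qed

lemma closedin_Rn_halfspace: "closedin (Rn_top n) {z \<in> Rn n. s \<le> Rn_inner n u z}"
proof -
  have "closedin (Rn_top n) {z \<in> topspace (Rn_top n). Rn_inner n u z \<in> {s..}}"
    by (rule closedin_continuous_map_preimage[OF continuous_map_Rn_inner]) auto
  then show ?thesis by simp
qed

section \<open>Moments of linear functionals\<close>

locale centered_log_concave_prob = log_concave_prob +
  assumes centered: "centered_measure n \<mu>"
begin

lemma has_integral_Rn_inner: "has_bochner_integral \<mu> (Rn_inner n u) 0"
proof -
  have "has_bochner_integral \<mu> (\<lambda>z. \<Sum>i<n. u i * z i) (\<Sum>i<n. u i * 0)"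
    using centered unfolding centered_measure_def
    by (intro has_bochner_integral_sum has_bochner_integral_mult_right) auto
  then show ?thesis by (simp add: Rn_inner_def[abs_def])
qed

lemma integrable_Rn_inner: "integrable \<mu> (Rn_inner n u)"
  and expectation_Rn_inner: "expectation (Rn_inner n u) = 0"
  using has_integral_Rn_inner[of u] by (auto simp: has_bochner_integral_iff)

text \<open>Half-spaces with a common normal mix into a half-space at the mixed level.\<close>

lemma log_concave_variable_Rn_inner: "log_concave_variable \<mu> (Rn_inner n u)"
proof unfold_locales
  fix l s t :: real assume l: "0 < l" "l < 1"
  have "prob {z \<in> Rn n. s \<le> Rn_inner n u z} powr l * prob {z \<in> Rn n. t \<le> Rn_inner n u z} powr (1 - l)
      \<le> prob {z \<in> Rn n. l * s + (1 - l) * t \<le> Rn_inner n u z}"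
  proof (rule prob_ge_of_closedin)
    show "Rn_mix n l {z \<in> Rn n. s \<le> Rn_inner n u z} {z \<in> Rn n. t \<le> Rn_inner n u z}
        \<subseteq> {z \<in> Rn n. l * s + (1 - l) * t \<le> Rn_inner n u z}"
    proof
      fix x assume "x \<in> Rn_mix n l {z \<in> Rn n. s \<le> Rn_inner n u z} {z \<in> Rn n. t \<le> Rn_inner n u z}"
      then obtain a b where x: "x = (\<lambda>i\<in>{..<n}. l * a i + (1 - l) * b i)"
        and "s \<le> Rn_inner n u a" "t \<le> Rn_inner n u b"
        unfolding Rn_mix_def by blast
      then have "l * s + (1 - l) * t \<le> Rn_inner n u x"
        unfolding x Rn_inner_mix using l by (intro add_mono mult_left_mono) auto
      then show "x \<in> {z \<in> Rn n. l * s + (1 - l) * t \<le> Rn_inner n u z}"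
        unfolding x by simp
    qed
  qed (rule closedin_Rn_halfspace closedin_sets l | rule closedin_Rn_halfspace)+
  then show "prob {z \<in> space \<mu>. s \<le> Rn_inner n u z} powr l * prob {z \<in> space \<mu>. t \<le> Rn_inner n u z} powr (1 - l)
      \<le> prob {z \<in> space \<mu>. l * s + (1 - l) * t \<le> Rn_inner n u z}"
    by (simp add: space_eq)
qed simp

text \<open>The positive parts of the functionals of \<open>u\<close> and \<open>-u\<close> add up
  to an L2 norm of at most 32m. Division by 128 = 4 * 32 matches the threshold m/4 of
  \<open>prob_ge_quarter_abs_moment\<close>. For m = 0 the functional vanishes almost
  everywhere.\<close>

lemma second_moment_Rn_inner:
  fixes u
  defines "m \<equiv> expectation (\<lambda>z. \<bar>Rn_inner n u z\<bar>)"
  shows "integrable \<mu> (\<lambda>z. (Rn_inner n u z)\<^sup>2)" (is ?A)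
    and "sqrt (expectation (\<lambda>z. (Rn_inner n u z)\<^sup>2)) / 128 \<le> m / 4" (is ?C)
proof -
  have *: "?A \<and> expectation (\<lambda>z. (Rn_inner n u z)\<^sup>2) \<le> (32 * m)\<^sup>2"
  proof (cases "m = 0")
    case True
    then have "AE z in \<mu>. Rn_inner n u z = 0"
      using integral_nonneg_eq_0_iff_AE[of \<mu> "\<lambda>z. \<bar>Rn_inner n u z\<bar>"] integrable_Rn_inner[of u]
      by (simp add: m_def)
    then have ae: "AE z in \<mu>. (Rn_inner n u z)\<^sup>2 = 0" by eventually_elim simp
    have "integrable \<mu> (\<lambda>z. (Rn_inner n u z)\<^sup>2) \<longleftrightarrow> integrable \<mu> (\<lambda>z. 0 :: real)"
      by (rule integrable_cong_AE) (use ae in auto)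
    moreover have "expectation (\<lambda>z. (Rn_inner n u z)\<^sup>2) = expectation (\<lambda>z. 0)"
      by (rule integral_cong_AE) (use ae in auto)
    ultimately show ?thesis by simp
  next
    case False
    moreover have "0 \<le> m" by (simp add: m_def)
    ultimately have m: "0 < m" by simp
    define v where "v = (\<lambda>k. - u k)"
    interpret U: log_concave_variable \<mu> "Rn_inner n u" by (rule log_concave_variable_Rn_inner)
    interpret V: log_concave_variable \<mu> "Rn_inner n v" by (rule log_concave_variable_Rn_inner)
    have mv: "m = expectation (\<lambda>z. \<bar>Rn_inner n v z\<bar>)"
      by (simp add: m_def v_def Rn_inner_minus_left)
    have "(\<integral>\<^sup>+z. ennreal ((Rn_inner n u z)\<^sup>2) \<partial>\<mu>)
        = (\<integral>\<^sup>+z. ennreal ((max 0 (Rn_inner n u z))\<^sup>2) + ennreal ((max 0 (Rn_inner n v z))\<^sup>2) \<partial>\<mu>)"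
      by (intro nn_integral_cong) (auto simp: v_def Rn_inner_minus_left max_def simp flip: ennreal_plus)
    also have "\<dots> = (\<integral>\<^sup>+z. ennreal ((max 0 (Rn_inner n u z))\<^sup>2) \<partial>\<mu>) + (\<integral>\<^sup>+z. ennreal ((max 0 (Rn_inner n v z))\<^sup>2) \<partial>\<mu>)"
      by (intro nn_integral_add) auto
    also have "\<dots> \<le> ennreal (512 * m\<^sup>2) + ennreal (512 * m\<^sup>2)"
      using U.nn_integral_pos_part_sq_le[OF integrable_Rn_inner m_def[THEN meta_eq_to_obj_eq] m]
        V.nn_integral_pos_part_sq_le[OF integrable_Rn_inner mv m] by (rule add_mono)
    also have "\<dots> = ennreal ((32 * m)\<^sup>2)"
      by (simp add: power_mult_distrib flip: ennreal_plus)
    finally have le: "(\<integral>\<^sup>+z. ennreal ((Rn_inner n u z)\<^sup>2) \<partial>\<mu>) \<le> ennreal ((32 * m)\<^sup>2)" .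
    have int: ?A
    proof (rule integrableI_nonneg)
      show "(\<integral>\<^sup>+z. ennreal ((Rn_inner n u z)\<^sup>2) \<partial>\<mu>) < \<infinity>"
        using le by (rule le_less_trans) simp
    qed auto
    with le show ?thesis
      by (simp add: nn_integral_eq_integral)
  qed
  then show ?A by blast
  have "0 \<le> m" by (simp add: m_def)
  then have "sqrt (expectation (\<lambda>z. (Rn_inner n u z)\<^sup>2)) \<le> 32 * m"
    using * by (intro real_le_lsqrt) auto
  then show ?C by simp
qed

text \<open>The first moment is traded for the L2 norm, since the latter becomes a Euclidean norm in
  orthonormal coordinates.\<close>

lemma prob_ge_second_moment:
  "1 / 8 \<le> prob {z \<in> Rn n. sqrt (expectation (\<lambda>z. (Rn_inner n u z)\<^sup>2)) / 128 \<le> Rn_inner n u z}"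
proof -
  define m where "m = expectation (\<lambda>z. \<bar>Rn_inner n u z\<bar>)"
  have "1 / 8 \<le> prob {z \<in> space \<mu>. m / 4 \<le> Rn_inner n u z}"
  proof (cases "m = 0")
    case True
    then have "AE z in \<mu>. Rn_inner n u z = 0"
      using integral_nonneg_eq_0_iff_AE[of \<mu> "\<lambda>z. \<bar>Rn_inner n u z\<bar>"] integrable_Rn_inner[of u]
      by (simp add: m_def)
    then have "AE z in \<mu>. z \<in> {z \<in> space \<mu>. m / 4 \<le> Rn_inner n u z}"
      using AE_space by eventually_elim (simp add: True)
    then have "prob {z \<in> space \<mu>. m / 4 \<le> Rn_inner n u z} = 1"
      by (intro prob_eq_1[THEN iffD2]) auto
    then show ?thesis by simp
  next
    case False
    moreover have "0 \<le> m" by (simp add: m_def)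
    ultimately have m: "0 < m" by simp
    interpret U: log_concave_variable \<mu> "Rn_inner n u" by (rule log_concave_variable_Rn_inner)
    show ?thesis
      using U.prob_ge_quarter_abs_moment[OF integrable_Rn_inner expectation_Rn_inner m_def m] .
  qed
  also have "\<dots> \<le> prob {z \<in> Rn n. sqrt (expectation (\<lambda>z. (Rn_inner n u z)\<^sup>2)) / 128 \<le> Rn_inner n u z}"
  proof (rule finite_measure_mono)
    have le: "sqrt (expectation (\<lambda>z. (Rn_inner n u z)\<^sup>2)) / 128 \<le> m / 4"
      unfolding m_def by (rule second_moment_Rn_inner(2))
    show "{z \<in> space \<mu>. m / 4 \<le> Rn_inner n u z}
        \<subseteq> {z \<in> Rn n. sqrt (expectation (\<lambda>z. (Rn_inner n u z)\<^sup>2)) / 128 \<le> Rn_inner n u z}"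
      unfolding space_eq using order_trans[OF le] by blast
    show "{z \<in> Rn n. sqrt (expectation (\<lambda>z. (Rn_inner n u z)\<^sup>2)) / 128 \<le> Rn_inner n u z} \<in> events"
      by (rule closedin_sets[OF closedin_Rn_halfspace])
  qed
  finally show ?thesis .
qed

text \<open>A vanishing second moment would concentrate the measure on a hyperplane through the
  origin. This is where the hyperplane condition enters.\<close>

lemma second_moment_pos:
  assumes "i < n" "u i \<noteq> 0"
  shows "0 < expectation (\<lambda>z. (Rn_inner n u z)\<^sup>2)"
proof (rule ccontr)
  assume "\<not> ?thesis"
  moreover have "0 \<le> expectation (\<lambda>z. (Rn_inner n u z)\<^sup>2)" by simp
  ultimately have "expectation (\<lambda>z. (Rn_inner n u z)\<^sup>2) = 0" by linarith
  then have ae: "AE z in \<mu>. Rn_inner n u z = 0"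
    using integral_nonneg_eq_0_iff_AE[of \<mu> "\<lambda>z. (Rn_inner n u z)\<^sup>2"] second_moment_Rn_inner(1)[of u]
    by simp
  \<comment> \<open>The normal of a hyperplane must lie in \<open>Rn n\<close>, hence the
    restriction; it does not change the functional.\<close>
  define H where "H = {x \<in> Rn n. Rn_inner n (restrict u {..<n}) x = 0}"
  have eq: "Rn_inner n (restrict u {..<n}) = Rn_inner n u"
    by (auto simp: Rn_inner_def fun_eq_iff)
  have "Rn_hyperplane n H"
    unfolding Rn_hyperplane_def H_def using assms
    by (intro bexI[of _ "restrict u {..<n}"] exI[of _ 0] conjI exI[of _ i]) auto
  then have "prob H < 1"
    using lc unfolding log_concave_measure_def by blast
  moreover have "AE z in \<mu>. z \<in> H"
    using ae AE_space unfolding H_def eq by eventually_elim (simp add: space_eq)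
  moreover have "H \<in> events"
  proof -
    have "H = {z \<in> space \<mu>. Rn_inner n u z = 0}" by (auto simp: H_def eq space_eq)
    then show ?thesis by simp
  qed
  ultimately show False
    using prob_eq_1[of H] by simp
qed

section \<open>Gram-Schmidt in L2 of the measure\<close>

lemma integrable_Rn_inner_mult: "integrable \<mu> (\<lambda>z. Rn_inner n u z * Rn_inner n v z)"
proof (rule Bochner_Integration.integrable_bound)
  show "integrable \<mu> (\<lambda>z. (Rn_inner n u z)\<^sup>2 + (Rn_inner n v z)\<^sup>2)"
    by (intro Bochner_Integration.integrable_add second_moment_Rn_inner)
  have "\<bar>a * b\<bar> \<le> \<bar>a\<^sup>2 + b\<^sup>2\<bar>" for a b :: real
  proof -
    have "2 * \<bar>a\<bar> * \<bar>b\<bar> \<le> \<bar>a\<bar>\<^sup>2 + \<bar>b\<bar>\<^sup>2" by (rule sum_squares_bound)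
    moreover have "0 \<le> \<bar>a\<bar> * \<bar>b\<bar>" by simp
    ultimately show ?thesis unfolding abs_mult by (simp; linarith)
  qed
  then show "AE z in \<mu>. norm (Rn_inner n u z * Rn_inner n v z) \<le> norm ((Rn_inner n u z)\<^sup>2 + (Rn_inner n v z)\<^sup>2)"
    by simp
qed simp

text \<open>As linear functionals have mean zero, this makes the covariance matrix of the
  functionals the identity: an isotropic position without a change of variables.\<close>

definition orthonormal :: "nat \<Rightarrow> (nat \<Rightarrow> nat \<Rightarrow> real) \<Rightarrow> bool" where
  "orthonormal k u \<longleftrightarrow>
    (\<forall>i<k. \<forall>j<k. expectation (\<lambda>z. Rn_inner n (u i) z * Rn_inner n (u j) z) = of_bool (i = j))"

lemma orthonormalD:
  "orthonormal k u \<Longrightarrow> i < k \<Longrightarrow> j < k \<Longrightarrow>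
    expectation (\<lambda>z. Rn_inner n (u i) z * Rn_inner n (u j) z) = of_bool (i = j)"
  by (simp add: orthonormal_def)

text \<open>Gram-Schmidt on the axis functionals. The triangular support condition gives the
  residual \<open>v\<close> of the next axis coefficient 1 at index \<open>k\<close>, so
  \<open>second_moment_pos\<close> permits normalizing it. The last clause is the span condition in
  coordinates.\<close>

lemma gram_schmidt:
  assumes "k \<le> n"
  shows "\<exists>u. orthonormal k u \<and>
    (\<forall>i<k. \<forall>l\<ge>k. u i l = 0) \<and> (\<forall>j<k. \<exists>c. \<forall>z. z j = (\<Sum>i<k. c i * Rn_inner n (u i) z))"
  using assms
proof (induction k)
  case 0
  then show ?case by (simp add: orthonormal_def)
next
  case (Suc k)
  from Suc.IH[OF Suc_leD[OF Suc.prems]] obtain u where u: "orthonormal k u"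
    "\<forall>i<k. \<forall>l\<ge>k. u i l = 0" "\<forall>j<k. \<exists>c. \<forall>z. z j = (\<Sum>i<k. c i * Rn_inner n (u i) z)"
    by (elim exE conjE)
  note ortho = orthonormalD[OF u(1)]
  have supp: "u i l = 0" if "i < k" "k \<le> l" for i l
    using u(2) that by simp
  have span: "\<exists>c. \<forall>z. z j = (\<Sum>i<k. c i * Rn_inner n (u i) z)" if "j < k" for j
    using u(3) that by simp
  define e :: "nat \<Rightarrow> real" where "e = (\<lambda>l. of_bool (l = k))"
  define q where "q i = expectation (\<lambda>z. Rn_inner n e z * Rn_inner n (u i) z)" for i
  define v where "v = (\<lambda>l. e l - (\<Sum>i<k. q i * u i l))"
  have e: "Rn_inner n e z = z k" for z
    unfolding e_def using Suc.prems by (intro Rn_inner_axis) auto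
  have v: "Rn_inner n v z = z k - (\<Sum>i<k. q i * Rn_inner n (u i) z)" for z
    unfolding v_def by (simp add: Rn_inner_diff_left Rn_inner_sum_left e)
  define s where "s = sqrt (expectation (\<lambda>z. (Rn_inner n v z)\<^sup>2))"
  have "v k = 1"
    unfolding v_def e_def using supp by simp
  then have pos: "0 < expectation (\<lambda>z. (Rn_inner n v z)\<^sup>2)"
    using Suc.prems by (intro second_moment_pos[of k]) auto
  then have s: "0 < s" "s\<^sup>2 = expectation (\<lambda>z. (Rn_inner n v z)\<^sup>2)"
    by (auto simp: s_def)
  have perp: "expectation (\<lambda>z. Rn_inner n v z * Rn_inner n (u j) z) = 0" if "j < k" for j
  proof -
    have "expectation (\<lambda>z. Rn_inner n v z * Rn_inner n (u j) z)
        = expectation (\<lambda>z. Rn_inner n e z * Rn_inner n (u j) z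
            - (\<Sum>i<k. q i * (Rn_inner n (u i) z * Rn_inner n (u j) z)))"
      by (intro Bochner_Integration.integral_cong)
        (auto simp: v e algebra_simps sum_distrib_left)
    also have "\<dots> = q j - (\<Sum>i<k. q i * expectation (\<lambda>z. Rn_inner n (u i) z * Rn_inner n (u j) z))"
    proof -
      have "integrable \<mu> (\<lambda>z. \<Sum>i<k. q i * (Rn_inner n (u i) z * Rn_inner n (u j) z))"
        by (intro Bochner_Integration.integrable_sum integrable_mult_right integrable_Rn_inner_mult)
      moreover have "expectation (\<lambda>z. \<Sum>i<k. q i * (Rn_inner n (u i) z * Rn_inner n (u j) z))
          = (\<Sum>i<k. expectation (\<lambda>z. q i * (Rn_inner n (u i) z * Rn_inner n (u j) z)))"
        by (intro Bochner_Integration.integral_sum integrable_mult_right integrable_Rn_inner_mult)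
      ultimately show ?thesis
        using integrable_Rn_inner_mult by (simp add: q_def)
    qed
    also have "(\<Sum>i<k. q i * expectation (\<lambda>z. Rn_inner n (u i) z * Rn_inner n (u j) z)) = q j"
    proof -
      have "(\<Sum>i<k. q i * expectation (\<lambda>z. Rn_inner n (u i) z * Rn_inner n (u j) z)) = (\<Sum>i<k. if i = j then q i else 0)"
        using that by (intro sum.cong) (auto simp: ortho)
      then show ?thesis using that by simp
    qed
    finally show ?thesis by simp
  qed
  define w where "w = u(k := (\<lambda>l. v l / s))"
  have wk: "Rn_inner n (w k) z = Rn_inner n v z / s" for z
    by (simp add: w_def Rn_inner_scale_left)
  have wi: "w i = u i" if "i < k" for i using that by (simp add: w_def)
  have ow: "expectation (\<lambda>z. Rn_inner n (w i) z * Rn_inner n (w j) z) = of_bool (i = j)"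
    if "i < Suc k" "j < Suc k" for i j
  proof -
    consider "i < k" "j < k" | "i = k" "j < k" | "i < k" "j = k" | "i = k" "j = k"
      using \<open>i < Suc k\<close> \<open>j < Suc k\<close> by linarith
    then show ?thesis
    proof cases
      case 1
      then show ?thesis by (simp add: wi ortho)
    next
      case 2
      then show ?thesis using perp[of j] by (simp add: wi wk)
    next
      case 3
      then show ?thesis using perp[of i] by (simp add: wi wk mult.commute)
    next
      case 4
      have "expectation (\<lambda>z. Rn_inner n v z / s * (Rn_inner n v z / s))
          = expectation (\<lambda>z. (Rn_inner n v z)\<^sup>2) / s\<^sup>2"
        by (simp add: power2_eq_square)
      also have "\<dots> = 1" unfolding s(2) using pos by simp
      finally have E1: "expectation (\<lambda>z. Rn_inner n v z / s * (Rn_inner n v z / s)) = 1" .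
      show ?thesis unfolding 4 wk E1 by simp
    qed
  qed
  have sw: "w i l = 0" if "i < Suc k" "Suc k \<le> l" for i l
    using that supp by (cases "i = k") (auto simp: w_def v_def e_def)
  have "\<exists>c. \<forall>z. z j = (\<Sum>i<Suc k. c i * Rn_inner n (w i) z)" if "j < Suc k" for j
  proof (cases "j = k")
    case True
    \<comment> \<open>Solves the definition of \<open>v\<close> for the axis functional, with v = s
      * w k.\<close>
    have "z k = (\<Sum>i<Suc k. (q(k := s)) i * Rn_inner n (w i) z)" for z
      using s(1) v[of z] by (simp add: wi wk)
    then show ?thesis using True by blast
  next
    case False
    with \<open>j < Suc k\<close> have "j < k" by simp
    from span[OF this] obtain c where c: "\<forall>z. z j = (\<Sum>i<k. c i * Rn_inner n (u i) z)"
      by (elim exE)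
    have "z j = (\<Sum>i<Suc k. (c(k := 0)) i * Rn_inner n (w i) z)" for z
      using c by (simp add: wi)
    then show ?thesis by blast
  qed
  with ow sw show ?case
    unfolding orthonormal_def by (intro exI[of _ w] conjI allI impI)
qed

lemma orthonormal_basis:
  "\<exists>u. orthonormal n u \<and> (\<forall>\<xi>. \<exists>c. \<forall>z. Rn_inner n \<xi> z = (\<Sum>i<n. c i * Rn_inner n (u i) z))"
proof -
  from gram_schmidt[OF order_refl] obtain u where u: "orthonormal n u"
    and span: "\<forall>j<n. \<exists>c. \<forall>z. z j = (\<Sum>i<n. c i * Rn_inner n (u i) z)"
    by (elim exE conjE)
  obtain c where c: "\<And>j z. j < n \<Longrightarrow> z j = (\<Sum>i<n. c j i * Rn_inner n (u i) z)"
    using span by metis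
  have "Rn_inner n \<xi> z = (\<Sum>i<n. (\<Sum>j<n. \<xi> j * c j i) * Rn_inner n (u i) z)" for \<xi> z
  proof -
    have "Rn_inner n \<xi> z = (\<Sum>j<n. \<xi> j * z j)"
      by (simp add: Rn_inner_def)
    also have "\<dots> = (\<Sum>j<n. \<Sum>i<n. \<xi> j * c j i * Rn_inner n (u i) z)"
    proof (intro sum.cong refl)
      fix j assume "j \<in> {..<n}"
      then have "z j = (\<Sum>i<n. c j i * Rn_inner n (u i) z)" using c by simp
      then show "\<xi> j * z j = (\<Sum>i<n. \<xi> j * c j i * Rn_inner n (u i) z)"
        by (simp add: sum_distrib_left mult_ac)
    qed
    also have "\<dots> = (\<Sum>i<n. \<Sum>j<n. \<xi> j * c j i * Rn_inner n (u i) z)"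
      by (rule sum.swap)
    finally show ?thesis by (simp add: sum_distrib_right)
  qed
  then have "\<exists>c. \<forall>z. Rn_inner n \<xi> z = (\<Sum>i<n. c i * Rn_inner n (u i) z)" for \<xi>
    by (intro exI[of _ "\<lambda>i. \<Sum>j<n. \<xi> j * c j i"] allI)
  with u show ?thesis by (intro exI[of _ u] conjI allI)
qed

end

section \<open>Heavy points\<close>

lemma Rn_inner_commute: "Rn_inner n u v = Rn_inner n v u"
  by (simp add: Rn_inner_def mult.commute)

locale orthonormal_frame = centered_log_concave_prob +
  fixes u :: "nat \<Rightarrow> nat \<Rightarrow> real"
  assumes ortho: "orthonormal n u"
    and span: "\<And>\<xi>. \<exists>c. \<forall>z. Rn_inner n \<xi> z = (\<Sum>i<n. c i * Rn_inner n (u i) z)"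
    and n_pos: "0 < n"
begin

definition coord :: "nat \<Rightarrow> (nat \<Rightarrow> real) \<Rightarrow> real" where
  "coord i z = Rn_inner n (u i) z"

lemma coord_mix: "coord i (\<lambda>i\<in>{..<n}. l * a i + (1 - l) * b i) = l * coord i a + (1 - l) * coord i b"
  unfolding coord_def by (rule Rn_inner_mix)

lemma coord_measurable [measurable]: "coord i \<in> borel_measurable \<mu>"
  unfolding coord_def[abs_def] by measurable

lemma integrable_coord_mult: "integrable \<mu> (\<lambda>z. coord i z * coord j z)"
  unfolding coord_def by (rule integrable_Rn_inner_mult)

lemma expectation_coord_mult: "i < n \<Longrightarrow> j < n \<Longrightarrow> expectation (\<lambda>z. coord i z * coord j z) = of_bool (i = j)"
  unfolding coord_def by (rule orthonormalD[OF ortho])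

text \<open>By orthonormality the L2 norm of the combination is the Euclidean norm of
  \<open>c\<close>, so \<open>prob_ge_second_moment\<close> applies.\<close>

lemma prob_combination_ge:
  "1 / 8 \<le> prob {z \<in> Rn n. sqrt (\<Sum>i<n. (c i)\<^sup>2) / 128 \<le> (\<Sum>i<n. c i * coord i z)}"
proof -
  define v where "v = (\<lambda>k. \<Sum>i<n. c i * u i k)"
  have v: "Rn_inner n v z = (\<Sum>i<n. c i * coord i z)" for z
    unfolding v_def coord_def by (rule Rn_inner_sum_left)
  have "expectation (\<lambda>z. (Rn_inner n v z)\<^sup>2)
      = expectation (\<lambda>z. \<Sum>i<n. \<Sum>j<n. c i * c j * (coord i z * coord j z))"
    by (simp add: v power2_eq_square sum_product mult_ac)
  also have "\<dots> = (\<Sum>i<n. expectation (\<lambda>z. \<Sum>j<n. c i * c j * (coord i z * coord j z)))"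
    by (intro Bochner_Integration.integral_sum Bochner_Integration.integrable_sum
        integrable_mult_right integrable_coord_mult)
  also have "\<dots> = (\<Sum>i<n. (c i)\<^sup>2)"
  proof (intro sum.cong refl)
    fix i assume i: "i \<in> {..<n}"
    have "expectation (\<lambda>z. \<Sum>j<n. c i * c j * (coord i z * coord j z))
        = (\<Sum>j<n. expectation (\<lambda>z. c i * c j * (coord i z * coord j z)))"
      by (intro Bochner_Integration.integral_sum integrable_mult_right integrable_coord_mult)
    also have "\<dots> = (\<Sum>j<n. if j = i then (c i)\<^sup>2 else 0)"
      using i by (intro sum.cong refl) (auto simp: expectation_coord_mult power2_eq_square)
    finally show "expectation (\<lambda>z. \<Sum>j<n. c i * c j * (coord i z * coord j z)) = (c i)\<^sup>2"
      using i by simp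
  qed
  finally show ?thesis
    using prob_ge_second_moment[of v] by (simp only: v)
qed

lemma prob_abs_coord_ge:
  assumes "i < n" "0 < R"
  shows "prob {z \<in> Rn n. R \<le> \<bar>coord i z\<bar>} \<le> 1 / R\<^sup>2"
proof -
  have "prob {z \<in> space \<mu>. R\<^sup>2 \<le> (coord i z)\<^sup>2} \<le> expectation (\<lambda>z. (coord i z)\<^sup>2) / R\<^sup>2"
    using integral_Markov_inequality_measure[of \<mu> "\<lambda>z. (coord i z)\<^sup>2" "{}" "R\<^sup>2"] assms
      integrable_coord_mult[of i i] by (simp add: power2_eq_square)
  also have "expectation (\<lambda>z. (coord i z)\<^sup>2) = 1"
    using expectation_coord_mult[of i i] assms by (simp add: power2_eq_square)
  also have "{z \<in> space \<mu>. R\<^sup>2 \<le> (coord i z)\<^sup>2} = {z \<in> Rn n. R \<le> \<bar>coord i z\<bar>}"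
    using assms by (auto simp: space_eq abs_le_square_iff[symmetric])
  finally show ?thesis .
qed

lemma closedin_slabs: "closedin (Rn_top n) {z \<in> Rn n. \<forall>i<n. coord i z \<in> {a i..b i}}"
proof -
  have "closedin (Rn_top n) (\<Inter>i\<in>{..<n}. {z \<in> topspace (Rn_top n). Rn_inner n (u i) z \<in> {a i..b i}})"
    using n_pos by (intro closedin_INT closedin_continuous_map_preimage[OF continuous_map_Rn_inner]) auto
  also have "(\<Inter>i\<in>{..<n}. {z \<in> topspace (Rn_top n). Rn_inner n (u i) z \<in> {a i..b i}})
      = {z \<in> Rn n. \<forall>i<n. coord i z \<in> {a i..b i}}"
    using n_pos by (auto simp: coord_def)
  finally show ?thesis .
qed

definition cube :: "(nat \<Rightarrow> real) \<Rightarrow> real \<Rightarrow> (nat \<Rightarrow> real) set" where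
  "cube x w = {z \<in> Rn n. \<forall>i<n. coord i z \<in> {coord i x - w..coord i x + w}}"

lemma closedin_cube: "closedin (Rn_top n) (cube x w)"
  unfolding cube_def by (rule closedin_slabs)

lemma cubeD: "z \<in> cube x w \<Longrightarrow> i < n \<Longrightarrow> \<bar>coord i z - coord i x\<bar> \<le> w"
  by (auto simp: cube_def abs_le_iff; fastforce)

definition heavy :: "real \<Rightarrow> real \<Rightarrow> (nat \<Rightarrow> real) set" where
  "heavy w \<theta> = {x \<in> Rn n. \<theta> \<le> prob (cube x w)}"

text \<open>Two cubes of half-side \<open>w\<close> mix into the cube of the same half-side around
  the mixed centre, and the geometric mean of two numbers \<ge> \<theta> is again \<ge>
  \<theta>.\<close>

lemma heavy_convex:
  assumes a: "a \<in> heavy w \<theta>" and b: "b \<in> heavy w \<theta>" and l: "0 < l" "l < 1" and th: "0 < \<theta>"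
  shows "(\<lambda>i\<in>{..<n}. l * a i + (1 - l) * b i) \<in> heavy w \<theta>" (is "?m \<in> _")
proof -
  have "prob (cube a w) powr l * prob (cube b w) powr (1 - l) \<le> prob (cube ?m w)"
  proof (rule prob_ge_of_closedin[OF closedin_cube closedin_cube closedin_sets[OF closedin_cube] _ l])
    show "Rn_mix n l (cube a w) (cube b w) \<subseteq> cube ?m w"
    proof
      fix x assume "x \<in> Rn_mix n l (cube a w) (cube b w)"
      then obtain a' b' where x: "x = (\<lambda>i\<in>{..<n}. l * a' i + (1 - l) * b' i)"
        and ab: "a' \<in> cube a w" "b' \<in> cube b w"
        unfolding Rn_mix_def by blast
      have "coord i x \<in> {coord i ?m - w..coord i ?m + w}" if "i < n" for i
      proof -
        have "\<bar>l * (coord i a' - coord i a) + (1 - l) * (coord i b' - coord i b)\<bar>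
            \<le> \<bar>l * (coord i a' - coord i a)\<bar> + \<bar>(1 - l) * (coord i b' - coord i b)\<bar>"
          by (rule abs_triangle_ineq)
        also have "\<dots> \<le> l * w + (1 - l) * w"
          using cubeD[OF ab(1) that] cubeD[OF ab(2) that] l
          by (intro add_mono) (auto simp: abs_mult intro!: mult_left_mono)
        finally have "\<bar>coord i x - coord i ?m\<bar> \<le> w"
          unfolding x coord_mix by (simp add: algebra_simps)
        then show ?thesis by (auto simp: abs_le_iff)
      qed
      then show "x \<in> cube ?m w"
        unfolding cube_def x by simp
    qed
  qed
  moreover have "\<theta> powr l * \<theta> powr (1 - l) \<le> prob (cube a w) powr l * prob (cube b w) powr (1 - l)"
    using a b l th by (intro mult_mono powr_mono2) (auto simp: heavy_def)
  moreover have "\<theta> powr l * \<theta> powr (1 - l) = \<theta>"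
    using th by (simp flip: powr_add)
  ultimately show ?thesis
    by (simp add: heavy_def)
qed

text \<open>\<open>G\<close> is the union of those grid cells of side \<open>w\<close> that have
  mass at least \<theta>. What is lost lies in light cells, at most (2M)^n of them, or has some
  coordinate of size at least Mw, which Chebyshev bounds. A finite union of closed cells keeps
  \<open>G\<close> closed, as mixing requires.\<close>

lemma heavy_grid:
  assumes w: "0 < w" and M: "0 < M" and th: "0 < \<theta>"
  obtains G where "closedin (Rn_top n) G" "G \<subseteq> heavy w \<theta>" "\<And>x i. x \<in> G \<Longrightarrow> i < n \<Longrightarrow> \<bar>coord i x\<bar> \<le> real M * w"
    "1 - real n / (real M * w)\<^sup>2 - (2 * real M) ^ n * \<theta> \<le> prob G"
proof -
  define K where "K = PiE {..<n} (\<lambda>_. {- int M..<int M})"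
  define cell where "cell k = {z \<in> Rn n. \<forall>i<n. coord i z \<in> {w * of_int (k i)..w * (of_int (k i) + 1)}}" for k :: "nat \<Rightarrow> int"
  define good where "good = {k \<in> K. \<theta> \<le> prob (cell k)}"
  define G where "G = (\<Union>k\<in>good. cell k)"
  have K: "finite K" "card K = (2 * M) ^ n"
    by (auto simp: K_def card_PiE nat_mult_distrib power_mult_distrib intro!: finite_PiE)
  have fin: "finite good" "finite (K - good)" using K by (auto simp: good_def)
  have cell: "closedin (Rn_top n) (cell k)" for k
    unfolding cell_def by (rule closedin_slabs)
  have cell_sets: "cell k \<in> events" for k
    using cell closedin_sets by blast
  have G: "closedin (Rn_top n) G"
    unfolding G_def using fin cell by (intro closedin_Union) auto
  \<comment> \<open>The cell has side \<open>w\<close> and the cube half-side \<open>w\<close>, so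
    any point of the cell may serve as centre.\<close>
  have cell_cube: "cell k \<subseteq> cube x w" if x: "x \<in> cell k" for x k
  proof
    fix z assume z: "z \<in> cell k"
    have "coord i z \<in> {coord i x - w..coord i x + w}" if "i < n" for i
    proof -
      have "coord i x \<in> {w * of_int (k i)..w * (of_int (k i) + 1)}" "coord i z \<in> {w * of_int (k i)..w * (of_int (k i) + 1)}"
        using x z that by (auto simp: cell_def)
      then show ?thesis by (auto simp: algebra_simps)
    qed
    with z show "z \<in> cube x w" by (simp add: cube_def cell_def)
  qed
  have "G \<subseteq> heavy w \<theta>"
  proof
    fix x assume "x \<in> G"
    then obtain k where k: "k \<in> K" "\<theta> \<le> prob (cell k)" "x \<in> cell k"
      by (auto simp: G_def good_def)
    have "prob (cell k) \<le> prob (cube x w)"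
      by (intro finite_measure_mono cell_cube k closedin_sets closedin_cube)
    with k show "x \<in> heavy w \<theta>" by (auto simp: heavy_def cell_def)
  qed
  moreover have "\<bar>coord i x\<bar> \<le> real M * w" if "x \<in> G" "i < n" for x i
  proof -
    obtain k where k: "k \<in> K" "x \<in> cell k"
      using \<open>x \<in> G\<close> by (auto simp: G_def good_def)
    have "k i \<in> {- int M..<int M}"
      using PiE_mem[OF k(1)[unfolded K_def], of i] \<open>i < n\<close> by simp
    then have "- int M \<le> k i" "k i + 1 \<le> int M" by auto
    then have "- real M \<le> of_int (k i)" "of_int (k i) + 1 \<le> real M"
      by linarith+
    then have "w * (- real M) \<le> w * of_int (k i)" "w * (of_int (k i) + 1) \<le> w * real M"
      using w by (intro mult_left_mono; simp)+
    moreover have "coord i x \<in> {w * of_int (k i)..w * (of_int (k i) + 1)}"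
      using k(2) that by (auto simp: cell_def)
    ultimately show ?thesis by (auto simp: abs_le_iff mult.commute)
  qed
  moreover have "1 - real n / (real M * w)\<^sup>2 - (2 * real M) ^ n * \<theta> \<le> prob G"
  proof -
    define far where "far i = {z \<in> Rn n. real M * w \<le> \<bar>coord i z\<bar>}" for i
    have far_sets: "far i \<in> events" for i
    proof -
      have "far i = {z \<in> space \<mu>. real M * w \<le> \<bar>coord i z\<bar>}" by (simp add: far_def space_eq)
      then show ?thesis by simp
    qed
    have cover: "space \<mu> \<subseteq> G \<union> ((\<Union>k\<in>K - good. cell k) \<union> (\<Union>i<n. far i))"
    proof
      fix z assume z: "z \<in> space \<mu>"
      show "z \<in> G \<union> ((\<Union>k\<in>K - good. cell k) \<union> (\<Union>i<n. far i))"
      proof (cases "\<exists>i<n. z \<in> far i")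
        case True
        then show ?thesis by auto
      next
        case False
        define k where "k = (\<lambda>i\<in>{..<n}. \<lfloor>coord i z / w\<rfloor>)"
        have "- int M \<le> \<lfloor>coord i z / w\<rfloor> \<and> \<lfloor>coord i z / w\<rfloor> < int M" if "i < n" for i
        proof -
          have "\<bar>coord i z\<bar> < real M * w" using False that z by (auto simp: far_def space_eq)
          then have "- real M < coord i z / w" "coord i z / w < real M"
            using w by (auto simp: field_simps)
          then show ?thesis by (simp add: floor_less_iff le_floor_iff)
        qed
        then have "k \<in> K" by (auto simp: K_def k_def)
        moreover have "z \<in> cell k"
        proof -
          have "coord i z \<in> {w * of_int \<lfloor>coord i z / w\<rfloor>..w * (of_int \<lfloor>coord i z / w\<rfloor> + 1)}" for i
          proof -
            have "of_int \<lfloor>coord i z / w\<rfloor> \<le> coord i z / w" "coord i z / w \<le> of_int \<lfloor>coord i z / w\<rfloor> + 1"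
              by linarith+
            then have "of_int \<lfloor>coord i z / w\<rfloor> * w \<le> coord i z" "coord i z \<le> (of_int \<lfloor>coord i z / w\<rfloor> + 1) * w"
              by (simp_all only: pos_le_divide_eq[OF w] pos_divide_le_eq[OF w])
            then show ?thesis by (simp add: mult.commute)
          qed
          then show ?thesis using z by (auto simp: cell_def k_def space_eq)
        qed
        ultimately show ?thesis by (auto simp: G_def)
      qed
    qed
    have "1 = prob (space \<mu>)" by (simp add: prob_space)
    also have "\<dots> \<le> prob (G \<union> ((\<Union>k\<in>K - good. cell k) \<union> (\<Union>i<n. far i)))"
      using fin by (intro finite_measure_mono cover sets.Un sets.finite_UN closedin_sets[OF G] cell_sets far_sets) auto
    also have "\<dots> \<le> prob G + prob ((\<Union>k\<in>K - good. cell k) \<union> (\<Union>i<n. far i))"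
      using fin by (intro measure_Un_le sets.Un sets.finite_UN closedin_sets[OF G] cell_sets far_sets) auto
    also have "prob ((\<Union>k\<in>K - good. cell k) \<union> (\<Union>i<n. far i))
        \<le> prob (\<Union>k\<in>K - good. cell k) + prob (\<Union>i<n. far i)"
      using fin by (intro measure_Un_le sets.finite_UN cell_sets far_sets) auto
    also have "prob (\<Union>k\<in>K - good. cell k) \<le> (\<Sum>k\<in>K - good. prob (cell k))"
      using fin cell_sets by (intro finite_measure_subadditive_finite) auto
    also have "\<dots> \<le> (\<Sum>k\<in>K. \<theta>)"
    proof (rule order_trans)
      show "(\<Sum>k\<in>K - good. prob (cell k)) \<le> (\<Sum>k\<in>K - good. \<theta>)"
        by (intro sum_mono) (auto simp: good_def)
      show "(\<Sum>k\<in>K - good. \<theta>) \<le> (\<Sum>k\<in>K. \<theta>)"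
        using K th by (intro sum_mono2) auto
    qed
    also have "\<dots> = (2 * real M) ^ n * \<theta>"
      using K by simp
    also have "prob (\<Union>i<n. far i) \<le> (\<Sum>i<n. prob (far i))"
      using far_sets by (intro finite_measure_subadditive_finite) auto
    also have "\<dots> \<le> (\<Sum>i<n. 1 / (real M * w)\<^sup>2)"
      unfolding far_def using w M by (intro sum_mono prob_abs_coord_ge) auto
    finally show ?thesis by simp
  qed
  ultimately show thesis using that G by blast
qed

text \<open>
  Moving an almost norm-minimal heavy point \<open>p\<close> slightly towards a heavy point \<open>q\<close> with
  \<open>\<langle>p, q\<rangle> \<le> 0\<close> would decrease its norm too much; such a \<open>q\<close> exists because the half-space opposite
  to \<open>p\<close> has measure at least \<open>1 / 8\<close>.
\<close>

lemma heavy_near_barycenter: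
  assumes G: "closedin (Rn_top n) G" "G \<subseteq> heavy w \<theta>" "\<And>x i. x \<in> G \<Longrightarrow> i < n \<Longrightarrow> \<bar>coord i x\<bar> \<le> R"
    and prob_G: "7 / 8 < prob G" and th: "0 < \<theta>" and rho: "0 < \<rho>"
  shows "\<exists>p\<in>heavy w \<theta>. (\<Sum>i<n. (coord i p)\<^sup>2) \<le> \<rho>\<^sup>2"
proof (rule ccontr)
  define N where "N p = (\<Sum>i<n. (coord i p)\<^sup>2)" for p
  define I where "I = Inf (N ` heavy w \<theta>)"
  define D where "D = real n * R\<^sup>2"
  \<comment> \<open>Chosen so that s * D = \<rho>^2/2: the term s^2 * N q then cancels only half of
    the decrease s * N p.\<close>
  define s where "s = \<rho>\<^sup>2 / (2 * D)"
  assume "\<not> ?thesis"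
  then have far: "\<rho>\<^sup>2 < N p" if "p \<in> heavy w \<theta>" for p
    using that by (auto simp: N_def not_le)
  have bdd: "bdd_below (N ` heavy w \<theta>)"
    by (rule bdd_belowI[of _ 0]) (auto simp: N_def sum_nonneg)
  have D: "N q \<le> D" if "q \<in> G" for q
  proof -
    have "(coord i q)\<^sup>2 \<le> R\<^sup>2" if "i < n" for i
      using G(3)[OF \<open>q \<in> G\<close> that] by (metis abs_ge_zero power2_abs power_mono)
    then have "N q \<le> (\<Sum>i<n. R\<^sup>2)"
      unfolding N_def by (intro sum_mono) auto
    then show ?thesis by (simp add: D_def)
  qed
  have "G \<noteq> {}" using prob_G by auto
  then obtain q0 where q0: "q0 \<in> G" by blast
  then have D_gt: "\<rho>\<^sup>2 < D"
    using far[of q0] D[of q0] G(2) by auto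
  moreover have sq: "0 < \<rho>\<^sup>2" using rho by simp
  ultimately have D0: "0 < D" by linarith
  have s: "0 < s" "s < 1" "s * D = \<rho>\<^sup>2 / 2"
  proof -
    show "0 < s" unfolding s_def using D0 sq by (intro divide_pos_pos) auto
    show "s < 1" unfolding s_def using D0 D_gt by (simp only: divide_less_eq) simp
    show "s * D = \<rho>\<^sup>2 / 2" unfolding s_def using D0 by simp
  qed
  have "\<rho>\<^sup>2 \<le> I"
    unfolding I_def using q0 G(2) by (intro cInf_greatest) (auto dest: far less_imp_le)
  \<comment> \<open>The infimum need not be attained; the slack equals the net decrease s *
    \<rho>^2/2 obtained below, so the moved point falls strictly under \<open>I\<close>.\<close>
  have "\<exists>v\<in>N ` heavy w \<theta>. v < I + s * \<rho>\<^sup>2 / 2"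
    using q0 G(2) s rho unfolding I_def by (intro cInf_lessD) auto
  then obtain p where p: "p \<in> heavy w \<theta>" "N p < I + s * \<rho>\<^sup>2 / 2" by auto
  define A where "A = {z \<in> Rn n. sqrt (\<Sum>i<n. (- coord i p)\<^sup>2) / 128 \<le> (\<Sum>i<n. - coord i p * coord i z)}"
  have "A = {z \<in> space \<mu>. sqrt (\<Sum>i<n. (- coord i p)\<^sup>2) / 128 \<le> (\<Sum>i<n. - coord i p * coord i z)}"
    by (simp add: A_def space_eq)
  then have A: "A \<in> events" by simp
  \<comment> \<open>Masses above 7/8 and at least 1/8 cannot be disjoint.\<close>
  have "G \<inter> A \<noteq> {}"
  proof
    assume "G \<inter> A = {}"
    then have "prob (G \<union> A) = prob G + prob A"
      using A closedin_sets[OF G(1)] by (intro finite_measure_Union) auto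
    moreover have "1 / 8 \<le> prob A"
      unfolding A_def by (rule prob_combination_ge)
    ultimately show False
      using prob_G prob_le_1[of "G \<union> A"] by linarith
  qed
  then obtain q where q: "q \<in> G" "q \<in> A" by blast
  have "0 \<le> sqrt (\<Sum>i<n. (- coord i p)\<^sup>2) / 128"
    by (simp add: sum_nonneg)
  also have "\<dots> \<le> (\<Sum>i<n. - coord i p * coord i q)"
    using q by (simp add: A_def)
  finally have neg: "(\<Sum>i<n. coord i p * coord i q) \<le> 0"
    by (simp add: sum_negf)
  define r where "r = (\<lambda>i\<in>{..<n}. (1 - s) * p i + (1 - (1 - s)) * q i)"
  have "r \<in> heavy w \<theta>"
    unfolding r_def using p(1) q(1) G(2) s th by (intro heavy_convex) auto
  then have "I \<le> N r"
    unfolding I_def by (intro cInf_lower bdd imageI)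
  also have "N r = (1 - s)\<^sup>2 * N p + 2 * (s * (1 - s)) * (\<Sum>i<n. coord i p * coord i q) + s\<^sup>2 * N q"
    unfolding N_def r_def coord_mix
    by (simp add: sum_distrib_left power2_eq_square algebra_simps flip: sum.distrib)
  also have "\<dots> \<le> (1 - s) * N p + 0 + s * (s * D)"
  proof (intro add_mono)
    have "(1 - s)\<^sup>2 \<le> 1 - s" using s by (simp add: power2_eq_square mult_left_le)
    then show "(1 - s)\<^sup>2 * N p \<le> (1 - s) * N p"
      by (intro mult_right_mono) (auto simp: N_def sum_nonneg)
    show "2 * (s * (1 - s)) * (\<Sum>i<n. coord i p * coord i q) \<le> 0"
      using s neg by (intro mult_nonneg_nonpos) auto
    show "s\<^sup>2 * N q \<le> s * (s * D)"
      using D[OF q(1)] s by (simp add: power2_eq_square mult_left_mono)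
  qed
  also have "\<dots> = N p - s * N p + s * (\<rho>\<^sup>2 / 2)"
    unfolding s(3) by (simp add: algebra_simps)
  also have "\<dots> \<le> N p - s * \<rho>\<^sup>2 + s * (\<rho>\<^sup>2 / 2)"
    using far[OF p(1)] s by simp
  also have "\<dots> < I" using p(2) by (simp add: algebra_simps)
  finally show False by simp
qed

end

section \<open>Depth and the Cramer transform\<close>

context log_concave_prob
begin

text \<open>A sublevel set is an intersection over all \<xi> of half-spaces, of the whole space
  (infinite log-Laplace value) or of the empty set (value minus infinity). Closedness supplies all
  measurability needed of the Cramer transform.\<close>

lemma closedin_cramer_le: "closedin (Rn_top n) {x \<in> Rn n. cramer_transform n \<mu> x \<le> ereal t}"
proof -
  have "closedin (Rn_top n) (\<Inter>\<xi>\<in>Rn n. {x \<in> Rn n. ereal (Rn_inner n x \<xi>) - log_laplace n \<mu> \<xi> \<le> ereal t})"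
  proof (rule closedin_INT)
    fix \<xi> :: "nat \<Rightarrow> real"
    show "closedin (Rn_top n) {x \<in> Rn n. ereal (Rn_inner n x \<xi>) - log_laplace n \<mu> \<xi> \<le> ereal t}"
    proof (cases "log_laplace n \<mu> \<xi>")
      case (real r)
      have "closedin (Rn_top n) {x \<in> topspace (Rn_top n). Rn_inner n \<xi> x \<in> {..t + r}}"
        by (rule closedin_continuous_map_preimage[OF continuous_map_Rn_inner]) auto
      moreover have "ereal (Rn_inner n x \<xi>) - log_laplace n \<mu> \<xi> \<le> ereal t \<longleftrightarrow> Rn_inner n \<xi> x \<le> t + r" for x
        using Rn_inner_commute[of n x \<xi>] real by auto
      then have "{x \<in> Rn n. ereal (Rn_inner n x \<xi>) - log_laplace n \<mu> \<xi> \<le> ereal t}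
          = {x \<in> topspace (Rn_top n). Rn_inner n \<xi> x \<in> {..t + r}}"
        by simp
      ultimately show ?thesis by simp
    next
      case PInf
      then show ?thesis using closedin_topspace[of "Rn_top n"] by simp
    next
      case MInf
      then show ?thesis by simp
    qed
  qed (auto simp: PiE_eq_empty_iff)
  also have "(\<Inter>\<xi>\<in>Rn n. {x \<in> Rn n. ereal (Rn_inner n x \<xi>) - log_laplace n \<mu> \<xi> \<le> ereal t})
      = {x \<in> Rn n. cramer_transform n \<mu> x \<le> ereal t}"
    unfolding cramer_transform_def by (auto simp: SUP_le_iff PiE_eq_empty_iff)
  finally show ?thesis .
qed

text \<open>Exponential Markov inequality: the half-space in direction \<xi> alone contributes at
  least \<kappa> * exp\<langle>\<xi>, x\<rangle> to the Laplace transform, so each term of the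
  supremum is at most -ln \<kappa>.\<close>

lemma cramer_le_of_depth:
  assumes k: "0 < \<kappa>" and depth: "\<And>\<xi>. \<xi> \<in> Rn n \<Longrightarrow> \<kappa> \<le> prob {z \<in> Rn n. Rn_inner n \<xi> x \<le> Rn_inner n \<xi> z}"
  shows "cramer_transform n \<mu> x \<le> ereal (- ln \<kappa>)"
  unfolding cramer_transform_def
proof (rule SUP_least)
  fix \<xi> assume xi: "\<xi> \<in> Rn n"
  define J where "J = (\<integral>\<^sup>+z. ennreal (exp (Rn_inner n \<xi> z)) \<partial>\<mu>)"
  define H where "H = {z \<in> Rn n. Rn_inner n \<xi> x \<le> Rn_inner n \<xi> z}"
  have H: "H \<in> events"
    unfolding H_def by (intro closedin_sets closedin_Rn_halfspace)
  have "ennreal (exp (Rn_inner n \<xi> x) * \<kappa>) \<le> ennreal (exp (Rn_inner n \<xi> x)) * emeasure \<mu> H"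
    using depth[OF xi] k
    by (subst ennreal_mult) (auto simp: emeasure_eq_measure H_def intro!: mult_left_mono ennreal_leI)
  also have "\<dots> = (\<integral>\<^sup>+z. ennreal (exp (Rn_inner n \<xi> x)) * indicator H z \<partial>\<mu>)"
    using H by (simp add: nn_integral_cmult_indicator)
  also have "\<dots> \<le> J"
    unfolding J_def by (intro nn_integral_mono) (auto simp: indicator_def H_def intro: ennreal_leI)
  finally have J: "ennreal (exp (Rn_inner n \<xi> x) * \<kappa>) \<le> J" .
  have pos: "0 < exp (Rn_inner n \<xi> x) * \<kappa>" using k by simp
  show "ereal (Rn_inner n x \<xi>) - log_laplace n \<mu> \<xi> \<le> ereal (- ln \<kappa>)"
  proof (cases "J = top")
    case True
    then have "log_laplace n \<mu> \<xi> = \<infinity>"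
      by (simp add: log_laplace_def ennreal_ln_def flip: J_def)
    then show ?thesis by simp
  next
    case False
    then have le: "exp (Rn_inner n \<xi> x) * \<kappa> \<le> enn2real J"
      using J pos by (metis enn2real_ennreal enn2real_mono less_eq_real_def top.not_eq_extremum)
    then have "ln (exp (Rn_inner n \<xi> x) * \<kappa>) \<le> ln (enn2real J)"
      using pos by (subst ln_le_cancel_iff) linarith+
    moreover have "ln (exp (Rn_inner n \<xi> x) * \<kappa>) = Rn_inner n \<xi> x + ln \<kappa>"
      using k by (simp add: ln_mult)
    moreover have "J \<noteq> 0" using le pos by auto
    then have "log_laplace n \<mu> \<xi> = ereal (ln (enn2real J))"
      using False by (simp add: log_laplace_def ennreal_ln_def flip: J_def)
    ultimately show ?thesis
      by (simp add: Rn_inner_commute[of n x])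
  qed
qed

text \<open>Test the supremum with \<xi> = 0.\<close>

lemma cramer_nonneg: "0 \<le> cramer_transform n \<mu> x"
proof -
  define z0 where "z0 = (\<lambda>i\<in>{..<n}. 0 :: real)"
  have z0: "z0 \<in> Rn n" "Rn_inner n z0 z = 0" "Rn_inner n x z0 = 0" for z
    by (auto simp: z0_def Rn_inner_def)
  have "log_laplace n \<mu> z0 = 0"
    by (simp add: log_laplace_def z0 emeasure_space_1 ennreal_ln_def)
  then have "0 = ereal (Rn_inner n x z0) - log_laplace n \<mu> z0"
    using z0 by simp
  also have "\<dots> \<le> cramer_transform n \<mu> x"
    unfolding cramer_transform_def using z0 by (intro SUP_upper)
  finally show ?thesis .
qed

end

section \<open>Depth of mixtures and the tail of the Cramer transform\<close>

context orthonormal_frame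
begin

text \<open>In direction \<xi> the cube around \<open>q\<close> may fall short by S * w, and
  \<open>b\<close> may lie S * (\<rho> + w) ahead of the origin. The half-space \<open>A\<close>
  gains r/128, but only with weight \<epsilon>; hence \<open>w\<close> is proportional to
  \<epsilon>.\<close>

lemma depth_of_mix:
  assumes q: "q \<in> heavy w \<theta>" and b: "b \<in> cube p w" and p: "(\<Sum>i<n. (coord i p)\<^sup>2) \<le> (1 / (512 * real n))\<^sup>2"
    and e: "0 < \<epsilon>" "\<epsilon> < 1" and w: "w = \<epsilon> / (512 * real n)" and th: "0 < \<theta>" "\<theta> \<le> 1"
    and x: "x = (\<lambda>i\<in>{..<n}. (1 - \<epsilon>) * q i + (1 - (1 - \<epsilon>)) * b i)"
  shows "\<theta> / 8 \<le> prob {z \<in> Rn n. Rn_inner n \<xi> x \<le> Rn_inner n \<xi> z}"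
proof -
  define \<rho> where "\<rho> = 1 / (512 * real n)"
  obtain c where c: "\<And>z. Rn_inner n \<xi> z = (\<Sum>i<n. c i * coord i z)"
    using span[of \<xi>] unfolding coord_def by blast
  define r where "r = sqrt (\<Sum>i<n. (c i)\<^sup>2)"
  define S where "S = (\<Sum>i<n. \<bar>c i\<bar>)"
  have S0: "0 \<le> S" by (simp add: S_def sum_nonneg)
  have "\<bar>c i\<bar> \<le> r" if "i < n" for i
  proof -
    have "(c i)\<^sup>2 \<le> (\<Sum>i<n. (c i)\<^sup>2)" using that by (intro member_le_sum) auto
    then show ?thesis unfolding r_def by (intro real_le_rsqrt) simp
  qed
  \<comment> \<open>The l1 norm is at most \<open>n\<close> times the Euclidean norm, which explains
    the factor n in \<rho> = 1/(512n).\<close>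
  then have "S \<le> (\<Sum>i<n. r)" unfolding S_def by (intro sum_mono) auto
  then have Sr: "S * \<rho> \<le> r / 512"
    using n_pos by (simp add: \<rho>_def field_simps)
  have bound: "\<bar>\<Sum>i<n. c i * f i\<bar> \<le> S * t" if "\<And>i. i < n \<Longrightarrow> \<bar>f i\<bar> \<le> t" for f t
  proof -
    have "\<bar>\<Sum>i<n. c i * f i\<bar> \<le> (\<Sum>i<n. \<bar>c i * f i\<bar>)" by (rule sum_abs)
    also have "\<dots> \<le> (\<Sum>i<n. \<bar>c i\<bar> * t)"
      using that by (intro sum_mono) (auto simp: abs_mult intro!: mult_left_mono)
    finally show ?thesis by (simp add: S_def sum_distrib_right)
  qed
  have yb: "\<bar>coord i b\<bar> \<le> \<rho> + w" if "i < n" for i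
  proof -
    have "(coord i p)\<^sup>2 \<le> (\<Sum>i<n. (coord i p)\<^sup>2)" using that by (intro member_le_sum) auto
    then have "(coord i p)\<^sup>2 \<le> \<rho>\<^sup>2" using p by (simp add: \<rho>_def)
    then have "\<bar>coord i p\<bar> \<le> \<rho>" by (simp add: \<rho>_def power2_le_iff_abs_le)
    with cubeD[OF b that] show ?thesis by linarith
  qed
  have Lb: "(\<Sum>i<n. c i * coord i b) \<le> S * (\<rho> + w)"
    using bound[of "\<lambda>i. coord i b", OF yb] by linarith
  define A where "A = {z \<in> Rn n. r / 128 \<le> Rn_inner n \<xi> z}"
  have pA: "1 / 8 \<le> prob A"
    unfolding A_def c r_def by (rule prob_combination_ge)
  define H where "H = {z \<in> Rn n. Rn_inner n \<xi> x \<le> Rn_inner n \<xi> z}"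
  \<comment> \<open>Exponents below 1 only enlarge numbers in (0,1], so the bound does not
    deteriorate as \<epsilon> shrinks.\<close>
  have "\<theta> * (1 / 8) \<le> \<theta> powr (1 - \<epsilon>) * (1 / 8) powr \<epsilon>"
    using th e powr_mono'[of "1 - \<epsilon>" 1 \<theta>] powr_mono'[of \<epsilon> 1 "1 / 8"]
    by (intro mult_mono) auto
  also have "\<dots> \<le> prob (cube q w) powr (1 - \<epsilon>) * prob A powr (1 - (1 - \<epsilon>))"
  proof (rule mult_mono)
    show "\<theta> powr (1 - \<epsilon>) \<le> prob (cube q w) powr (1 - \<epsilon>)"
      using q th e by (intro powr_mono2) (auto simp: heavy_def)
    show "(1 / 8) powr \<epsilon> \<le> prob A powr (1 - (1 - \<epsilon>))"
      using pA e powr_mono2[of \<epsilon> "1 / 8" "prob A"] by simp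
  qed auto
  also have "\<dots> \<le> prob H"
  proof (rule prob_ge_of_closedin)
    show "closedin (Rn_top n) (cube q w)" by (rule closedin_cube)
    show "closedin (Rn_top n) A" unfolding A_def by (rule closedin_Rn_halfspace)
    show "H \<in> events" unfolding H_def by (intro closedin_sets closedin_Rn_halfspace)
    show "Rn_mix n (1 - \<epsilon>) (cube q w) A \<subseteq> H"
    proof
      fix z assume "z \<in> Rn_mix n (1 - \<epsilon>) (cube q w) A"
      then obtain z1 z2 where z: "z = (\<lambda>i\<in>{..<n}. (1 - \<epsilon>) * z1 i + (1 - (1 - \<epsilon>)) * z2 i)"
        and z1: "z1 \<in> cube q w" and z2: "z2 \<in> A"
        unfolding Rn_mix_def by blast
      have "\<bar>\<Sum>i<n. c i * (coord i z1 - coord i q)\<bar> \<le> S * w"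
        by (rule bound) (rule cubeD[OF z1])
      then have L1: "Rn_inner n \<xi> q - S * w \<le> Rn_inner n \<xi> z1"
        by (simp add: c right_diff_distrib sum_subtractf abs_le_iff)
      have L2: "r / 128 \<le> Rn_inner n \<xi> z2" using z2 by (simp add: A_def)
      have "w = \<epsilon> * \<rho>" using w by (simp add: \<rho>_def)
      \<comment> \<open>After division by \<epsilon> the two errors add up to exactly 2 * S * \<rho>
        \<le> r/256.\<close>
      have key: "\<epsilon> * (S * (\<rho> + w)) \<le> \<epsilon> * (r / 128) - (1 - \<epsilon>) * (S * w)"
      proof -
        have "0 \<le> S * \<rho>" using S0 by (simp add: \<rho>_def)
        then have r0: "0 \<le> r" using Sr by linarith
        have Sw: "S * w = \<epsilon> * (S * \<rho>)" by (simp add: \<open>w = \<epsilon> * \<rho>\<close>)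
        have "S * (\<rho> + w) + (1 - \<epsilon>) * (S * \<rho>) = 2 * (S * \<rho>)"
          unfolding distrib_left Sw by (simp add: algebra_simps)
        also have "\<dots> \<le> r / 128" using Sr r0 by linarith
        finally have "\<epsilon> * (S * (\<rho> + w) + (1 - \<epsilon>) * (S * \<rho>)) \<le> \<epsilon> * (r / 128)"
          using e by (intro mult_left_mono) auto
        then show ?thesis unfolding Sw by (simp add: algebra_simps)
      qed
      have "Rn_inner n \<xi> x = (1 - \<epsilon>) * Rn_inner n \<xi> q + \<epsilon> * Rn_inner n \<xi> b"
        unfolding x Rn_inner_mix by simp
      also have "\<dots> \<le> (1 - \<epsilon>) * Rn_inner n \<xi> q + \<epsilon> * (S * (\<rho> + w))"
        using Lb e by (simp add: c)
      also have "\<dots> \<le> (1 - \<epsilon>) * Rn_inner n \<xi> q + (\<epsilon> * (r / 128) - (1 - \<epsilon>) * (S * w))"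
        using key by simp
      also have "\<dots> = (1 - \<epsilon>) * (Rn_inner n \<xi> q - S * w) + \<epsilon> * (r / 128)"
        by (simp add: algebra_simps)
      also have "\<dots> \<le> (1 - \<epsilon>) * Rn_inner n \<xi> z1 + \<epsilon> * Rn_inner n \<xi> z2"
        using L1 L2 e by (intro add_mono mult_left_mono) auto
      also have "\<dots> = Rn_inner n \<xi> z"
        unfolding z Rn_inner_mix by simp
      finally show "z \<in> H" by (simp add: H_def z)
    qed
  qed (use e in auto)
  finally show ?thesis by (simp add: H_def)
qed

text \<open>With \<epsilon> = 1/N, mixing the grid set \<open>G\<close> with one cube around
  \<open>p\<close> stays inside the sublevel set. The cube costs only the factor \<theta>^\<epsilon>
  \<ge> 1 + \<epsilon> ln \<theta> \<ge> 1 - \<epsilon> t, and \<open>G\<close> costs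
  \<delta>.\<close>

lemma prob_cramer_gt:
  fixes N :: nat
  assumes N: "2 \<le> N" and small: "real n / (real N)\<^sup>2 + 1 / real N < 1 / 8"
    and \<theta>: "\<theta> = 1 / (real N * (1024 * real n * (real N)\<^sup>2) ^ n)" and t: "ln (8 / \<theta>) \<le> t"
  shows "prob {x \<in> Rn n. ereal t < cramer_transform n \<mu> x}
    \<le> real n / (real N)\<^sup>2 + 1 / real N + t / real N"
proof -
  \<comment> \<open>Makes the grid reach M * w = N, so Chebyshev loses n/N^2; \<theta> is set so
    that all light cells together lose 1/N.\<close>
  define M where "M = 512 * n * N\<^sup>2"
  define w where "w = 1 / real N / (512 * real n)"
  define \<delta> where "\<delta> = real n / (real N)\<^sup>2 + 1 / real N"
  have M: "0 < M" "real M * w = real N" "2 * real M = 1024 * real n * (real N)\<^sup>2"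
    using N n_pos by (auto simp: M_def w_def power2_eq_square)
  have w: "0 < w" using N n_pos by (simp add: w_def)
  have base: "1 \<le> real N * (1024 * real n * (real N)\<^sup>2) ^ n"
  proof -
    have "1 * 1 \<le> real N * (1024 * real n * (real N)\<^sup>2) ^ n"
    proof (intro mult_mono one_le_power)
      have "1 * 1 * 1 \<le> 1024 * real n * (real N)\<^sup>2"
        using N n_pos by (intro mult_mono one_le_power) auto
      then show "1 \<le> 1024 * real n * (real N)\<^sup>2" by simp
    qed (use N in auto)
    then show ?thesis by simp
  qed
  then have th: "0 < \<theta>" "\<theta> \<le> 1" by (auto simp: \<theta>)
  have "(2 * real M) ^ n * \<theta> = 1 / real N"
    using N n_pos by (simp add: \<theta> M(3))
  moreover obtain G where G: "closedin (Rn_top n) G" "G \<subseteq> heavy w \<theta>"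
    "\<And>x i. x \<in> G \<Longrightarrow> i < n \<Longrightarrow> \<bar>coord i x\<bar> \<le> real M * w"
    "1 - real n / (real M * w)\<^sup>2 - (2 * real M) ^ n * \<theta> \<le> prob G"
    using heavy_grid[OF w M(1) th(1)] by blast
  ultimately have pG: "1 - \<delta> \<le> prob G"
    by (simp add: \<delta>_def M(2))
  then have "7 / 8 < prob G" using small by (simp add: \<delta>_def)
  then obtain p where p: "p \<in> heavy w \<theta>" "(\<Sum>i<n. (coord i p)\<^sup>2) \<le> (1 / (512 * real n))\<^sup>2"
    using heavy_near_barycenter[OF G(1-3) _ th(1), of "1 / (512 * real n)"] n_pos by auto
  define \<epsilon> where "\<epsilon> = 1 / real N"
  have e: "0 < \<epsilon>" "\<epsilon> < 1" using N by (auto simp: \<epsilon>_def)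
  define C where "C = {x \<in> Rn n. cramer_transform n \<mu> x \<le> ereal t}"
  have C: "C \<in> events"
    unfolding C_def by (intro closedin_sets closedin_cramer_le)
  have "Rn_mix n (1 - \<epsilon>) G (cube p w) \<subseteq> C"
  proof
    fix x assume "x \<in> Rn_mix n (1 - \<epsilon>) G (cube p w)"
    then obtain q b where x: "x = (\<lambda>i\<in>{..<n}. (1 - \<epsilon>) * q i + (1 - (1 - \<epsilon>)) * b i)"
      and q: "q \<in> G" and b: "b \<in> cube p w"
      unfolding Rn_mix_def by blast
    have "cramer_transform n \<mu> x \<le> ereal (- ln (\<theta> / 8))"
    proof (rule cramer_le_of_depth)
      show "\<theta> / 8 \<le> prob {z \<in> Rn n. Rn_inner n \<xi> x \<le> Rn_inner n \<xi> z}" for \<xi>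
        using q G(2) by (intro depth_of_mix[OF _ b p(2) e _ th x]) (auto simp: w_def \<epsilon>_def)
    qed (use th in auto)
    also have "- ln (\<theta> / 8) = ln (8 / \<theta>)" using th by (simp add: ln_div)
    also have "ereal (ln (8 / \<theta>)) \<le> ereal t" using t by simp
    finally have "cramer_transform n \<mu> x \<le> ereal t" .
    moreover have "x \<in> Rn n" by (simp add: x)
    ultimately show "x \<in> C" unfolding C_def by blast
  qed
  then have "prob G powr (1 - \<epsilon>) * prob (cube p w) powr (1 - (1 - \<epsilon>)) \<le> prob C"
    using e by (intro prob_ge_of_closedin[OF G(1) closedin_cube C]) auto
  \<comment> \<open>If the second factor is negative, the left side is \<le> 0 and the claim is
    trivial; otherwise the factors are compared separately.\<close>
  moreover have "(1 - \<delta>) * (1 - \<epsilon> * t) \<le> prob G powr (1 - \<epsilon>) * prob (cube p w) powr (1 - (1 - \<epsilon>))"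
  proof (cases "0 \<le> 1 - \<epsilon> * t")
    case True
    show ?thesis
    proof (intro mult_mono)
      have "0 < prob G" using \<open>7 / 8 < prob G\<close> by simp
      then have "prob G \<le> prob G powr (1 - \<epsilon>)"
        using e powr_mono'[of "1 - \<epsilon>" 1 "prob G"] by simp
      with pG show "1 - \<delta> \<le> prob G powr (1 - \<epsilon>)" by simp
      have "1 - \<epsilon> * t \<le> 1 + \<epsilon> * ln \<theta>"
      proof -
        have "- ln \<theta> \<le> t" using t th by (simp add: ln_div) (smt (verit) ln_ge_zero)
        then have "\<epsilon> * (- ln \<theta>) \<le> \<epsilon> * t" using e by (intro mult_left_mono) auto
        then show ?thesis by simp
      qed
      also have "\<dots> \<le> exp (\<epsilon> * ln \<theta>)" by (rule exp_ge_add_one_self)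
      also have "\<dots> = \<theta> powr \<epsilon>" using th by (simp add: powr_def)
      also have "\<dots> \<le> prob (cube p w) powr \<epsilon>"
        using p(1) th e by (intro powr_mono2) (auto simp: heavy_def)
      finally show "1 - \<epsilon> * t \<le> prob (cube p w) powr (1 - (1 - \<epsilon>))" by simp
    qed (use True in auto)
  next
    case False
    have "\<delta> \<le> 1" using small unfolding \<delta>_def by linarith
    then have "(1 - \<delta>) * (1 - \<epsilon> * t) \<le> 0"
      using False by (intro mult_nonneg_nonpos) auto
    then show ?thesis by (rule order_trans) simp
  qed
  moreover have "1 - \<delta> - \<epsilon> * t \<le> (1 - \<delta>) * (1 - \<epsilon> * t)"
  proof -
    have "0 \<le> \<delta> * (\<epsilon> * t)"
    proof -
      have "1 \<le> 8 / \<theta>" using th by (simp add: le_divide_eq)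
      then have "0 \<le> t" using order_trans[OF ln_ge_zero t] by blast
      moreover have "0 \<le> \<delta>" by (simp add: \<delta>_def)
      ultimately show ?thesis using e by (intro mult_nonneg_nonneg) auto
    qed
    then show ?thesis by (simp add: algebra_simps)
  qed
  ultimately have "1 - \<delta> - \<epsilon> * t \<le> prob C" by linarith
  moreover have "prob {x \<in> Rn n. ereal t < cramer_transform n \<mu> x} = 1 - prob C"
  proof -
    have "{x \<in> Rn n. ereal t < cramer_transform n \<mu> x} = space \<mu> - C"
      unfolding C_def space_eq using not_le by blast
    then show ?thesis using prob_compl[OF C] by simp
  qed
  moreover have "\<epsilon> * t = t / real N" by (simp add: \<epsilon>_def)
  ultimately show ?thesis unfolding \<delta>_def by linarith
qed

end

section \<open>The second moment\<close>

context orthonormal_frame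
begin

text \<open>\<open>N\<close> grows like 2^j while ln(8/\<theta>) grows only linearly in j. The
  factor n^2 in \<open>N\<close> absorbs n ln n \<le> n^2 in \<open>t\<close>, leaving t/N \<le>
  2(j+1)/2^j without any dependence on n.\<close>

lemma prob_cramer_gt_geometric:
  assumes n2: "2 \<le> n"
  shows "prob {x \<in> Rn n. ereal (32 * (real n * ln (real n)) * (real j + 1)) < cramer_transform n \<mu> x}
    \<le> 3 * (real j + 1) * (1 / 2) ^ j"
proof -
  define N where "N = 16 * n\<^sup>2 * 2 ^ j"
  define t where "t = 32 * (real n * ln (real n)) * (real j + 1)"
  define \<theta> where "\<theta> = 1 / (real N * (1024 * real n * (real N)\<^sup>2) ^ n)"
  have rn: "2 \<le> real n" using n2 by simp
  have N_eq: "real N = 16 * (real n)\<^sup>2 * 2 ^ j" by (simp add: N_def)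
  have "2 * real n \<le> real n * real n"
    using rn by (intro mult_right_mono) auto
  then have n_sq: "2 * real n \<le> (real n)\<^sup>2" by (simp add: power2_eq_square)
  have N_ge: "16 * (real n)\<^sup>2 \<le> real N"
    unfolding N_eq using mult_left_mono[of 1 "2 ^ j" "16 * (real n)\<^sup>2"] by simp
  then have N_ge': "32 * real n \<le> real N" "64 \<le> real N"
    using n_sq rn by linarith+
  have N_pos: "0 < real N" using N_ge' by linarith
  have frac: "real n / (real N)\<^sup>2 \<le> 1 / real N"
    using N_ge' N_pos rn by (simp add: power2_eq_square field_simps)
  have "1 / real N \<le> 1 / 64"
    using N_ge' by (intro divide_left_mono) auto
  with frac have small: "real n / (real N)\<^sup>2 + 1 / real N < 1 / 8" by linarith
  have inv: "1 / real N \<le> (1 / 2) ^ j / 16"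
  proof -
    have "16 * 2 ^ j \<le> real N"
      unfolding N_eq using rn by (intro mult_right_mono) (auto simp: one_le_power)
    then have "1 / real N \<le> 1 / (16 * 2 ^ j)"
      by (intro divide_left_mono) (use N_pos in auto)
    then show ?thesis by (simp add: power_one_over)
  qed
  \<comment> \<open>As n \<ge> 2, all constants are swallowed by powers of n: 8 \<le> n^3, 16 \<le>
    n^4, 1024 \<le> n^10. The exponent 9 + j + (23 + 2j)n is then at most 32n(j+1).\<close>
  have "ln (8 / \<theta>) \<le> t"
  proof -
    have p2: "2 ^ k \<le> real n ^ k" for k using rn by (intro power_mono) auto
    have N_le: "real N \<le> real n ^ (6 + j)"
    proof -
      have "real N = 2 ^ 4 * (real n)\<^sup>2 * 2 ^ j" by (simp add: N_eq)
      also have "\<dots> \<le> real n ^ 4 * (real n)\<^sup>2 * real n ^ j"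
        by (intro mult_mono p2) auto
      finally show ?thesis by (simp flip: power_add)
    qed
    have "1024 * real n * (real N)\<^sup>2 \<le> real n ^ 10 * real n ^ 1 * (real n ^ (6 + j))\<^sup>2"
      using p2[of 10] by (intro mult_mono power_mono N_le) auto
    also have "\<dots> = real n ^ (10 + 1 + (6 + j) * 2)"
      by (simp only: power_add power_mult)
    also have "10 + 1 + (6 + j) * 2 = 23 + 2 * j" by simp
    finally have base: "1024 * real n * (real N)\<^sup>2 \<le> real n ^ (23 + 2 * j)" .
    have "8 / \<theta> = 2 ^ 3 * real N * (1024 * real n * (real N)\<^sup>2) ^ n"
      by (simp add: \<theta>_def)
    also have "\<dots> \<le> real n ^ 3 * real n ^ (6 + j) * (real n ^ (23 + 2 * j)) ^ n"
      by (intro mult_mono power_mono p2 N_le base) auto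
    also have "\<dots> = real n ^ (3 + (6 + j) + (23 + 2 * j) * n)"
      by (simp only: power_add power_mult)
    also have "\<dots> \<le> real n ^ (32 * n * (j + 1))"
    proof (rule power_increasing)
      have "9 + j \<le> (9 + j) * n" using n_pos by simp
      then show "3 + (6 + j) + (23 + 2 * j) * n \<le> 32 * n * (j + 1)"
        by (simp add: algebra_simps)
    qed (use rn in auto)
    finally have "ln (8 / \<theta>) \<le> ln (real n ^ (32 * n * (j + 1)))"
      using N_pos rn by (subst ln_le_cancel_iff) (auto simp: \<theta>_def)
    also have "\<dots> = t"
      using rn by (simp add: ln_realpow t_def algebra_simps)
    finally show ?thesis .
  qed
  then have "prob {x \<in> Rn n. ereal t < cramer_transform n \<mu> x}
      \<le> real n / (real N)\<^sup>2 + 1 / real N + t / real N"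
    using N_ge' by (intro prob_cramer_gt[OF _ small \<theta>_def]) auto
  also have "\<dots> \<le> (1 / 2) ^ j / 8 + 2 * (real j + 1) * (1 / 2) ^ j"
  proof (rule add_mono)
    show "real n / (real N)\<^sup>2 + 1 / real N \<le> (1 / 2) ^ j / 8"
      using frac inv by linarith
    have "ln (real n) \<le> real n" using ln_le_minus_one[of "real n"] rn by linarith
    then have "t \<le> 32 * (real n * real n) * (real j + 1)"
      unfolding t_def using rn by (intro mult_right_mono mult_left_mono) auto
    then have "t / real N \<le> 32 * (real n * real n) * (real j + 1) / real N"
      using N_pos by (intro divide_right_mono) auto
    also have "\<dots> = 2 * (real j + 1) * (1 / 2) ^ j"
      using rn by (simp add: N_eq power2_eq_square power_one_over divide_simps)
    finally show "t / real N \<le> 2 * (real j + 1) * (1 / 2) ^ j" .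
  qed
  also have "\<dots> \<le> 3 * (real j + 1) * (1 / 2) ^ j"
    by (simp add: algebra_simps)
  finally show ?thesis by (simp add: t_def)
qed

text \<open>A layer-cake sum over the levels t_j = 32L(j+1): above t_k and up to t_(k+1) the square
  is at most \<open>g k\<close>. It is carried out directly because
  \<open>nn_integral_steps_le\<close> handles real-valued functions, whereas the Cramer transform
  may be infinite.\<close>

lemma nn_integral_cramer_sq_le:
  assumes n2: "2 \<le> n"
  shows "(\<integral>\<^sup>+x. (e2ennreal \<bar>cramer_transform n \<mu> x\<bar>)\<^sup>2 \<partial>\<mu>) \<le> ennreal ((10000 * (real n * ln (real n)))\<^sup>2)"
proof -
  define L where "L = real n * ln (real n)"
  define t where "t j = 32 * L * (real j + 1)" for j :: nat
  define A where "A j = {x \<in> Rn n. ereal (t j) < cramer_transform n \<mu> x}" for j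
  define g where "g j = (t (Suc j))\<^sup>2" for j
  define F where "F x = ennreal ((t 0)\<^sup>2) + (\<Sum>j. ennreal (g j) * indicator (A j) x)" for x
  have L: "0 < L" using n2 by (simp add: L_def)
  have t: "0 < t j" for j using L by (simp add: t_def)
  have A: "A j \<in> events" for j
  proof -
    have "A j = space \<mu> - {x \<in> Rn n. cramer_transform n \<mu> x \<le> ereal (t j)}"
      unfolding A_def space_eq using not_le by blast
    then show ?thesis using closedin_sets[OF closedin_cramer_le] by auto
  qed
  have pA: "prob (A j) \<le> 3 * (real j + 1) * (1 / 2) ^ j" for j
    unfolding A_def t_def L_def by (rule prob_cramer_gt_geometric[OF n2])
  have partial: "(\<Sum>j\<in>J. ennreal (g j) * indicator (A j) x) \<le> F x" if "finite J" for J x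
  proof -
    have "(\<Sum>j\<in>J. ennreal (g j) * indicator (A j) x) \<le> (\<Sum>j. ennreal (g j) * indicator (A j) x)"
      using that by (intro sum_le_suminf) auto
    also have "\<dots> \<le> F x" by (simp add: F_def)
    finally show ?thesis .
  qed
  have pointwise: "(e2ennreal \<bar>cramer_transform n \<mu> x\<bar>)\<^sup>2 \<le> F x" if x: "x \<in> space \<mu>" for x
  proof (cases "cramer_transform n \<mu> x")
    case (real r)
    then have "0 \<le> r" using cramer_nonneg[of x] by simp
    have eq: "(e2ennreal \<bar>cramer_transform n \<mu> x\<bar>)\<^sup>2 = ennreal (r\<^sup>2)"
      using \<open>0 \<le> r\<close> by (simp add: real ennreal_power)
    obtain m0 where "r / (32 * L) \<le> real m0" using real_arch_simple by blast
    then have "r \<le> t m0" using L by (simp add: t_def field_simps)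
    \<comment> \<open>The first level not below \<open>r\<close>; if it is not level 0, its
      predecessor places \<open>x\<close> in \<open>A k\<close>.\<close>
    define m where "m = (LEAST m. r \<le> t m)"
    have m: "r \<le> t m" unfolding m_def using \<open>r \<le> t m0\<close> by (rule LeastI)
    then have le: "ennreal (r\<^sup>2) \<le> ennreal ((t m)\<^sup>2)"
      using \<open>0 \<le> r\<close> by (intro ennreal_leI power_mono) auto
    show ?thesis
    proof (cases m)
      case 0
      with le have "ennreal (r\<^sup>2) \<le> ennreal ((t 0)\<^sup>2) + 0" by simp
      also have "\<dots> \<le> F x" unfolding F_def by (intro add_left_mono) simp
      finally show ?thesis unfolding eq .
    next
      case (Suc k)
      have "\<not> r \<le> t k"
        using not_less_Least[of k "\<lambda>m. r \<le> t m"] Suc by (simp add: m_def[symmetric])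
      then have "x \<in> A k" using x by (simp add: A_def real space_eq)
      then have "ennreal ((t m)\<^sup>2) = (\<Sum>j\<in>{k}. ennreal (g j) * indicator (A j) x)"
        by (simp add: g_def Suc)
      also have "\<dots> \<le> F x" by (rule partial) simp
      finally show ?thesis unfolding eq using le by order
    qed
  next
    case PInf
    \<comment> \<open>An infinite value puts \<open>x\<close> in every \<open>A j\<close>, so
      \<open>m\<close> terms already contribute at least m * t_0^2, which exceeds any finite
      value.\<close>
    have "F x = top"
    proof (rule ccontr)
      assume "F x \<noteq> top"
      then obtain r where r: "F x = ennreal r" "0 \<le> r" by (cases "F x") auto
      obtain m where "r / (t 0)\<^sup>2 < real m" using reals_Archimedean2 by blast
      then have m: "r < real m * (t 0)\<^sup>2" using t[of 0] by (simp add: field_simps)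
      have "ennreal (real m * (t 0)\<^sup>2) = (\<Sum>j<m. ennreal ((t 0)\<^sup>2))"
        by (simp add: ennreal_mult ennreal_of_nat_eq_real_of_nat)
      also have "\<dots> \<le> (\<Sum>j<m. ennreal (g j) * indicator (A j) x)"
      proof (rule sum_mono)
        fix j
        have "x \<in> A j" using x by (simp add: A_def PInf space_eq)
        moreover have "t 0 \<le> t (Suc j)" using L by (simp add: t_def)
        then have "(t 0)\<^sup>2 \<le> g j" unfolding g_def using t[of 0] by (intro power_mono) auto
        ultimately show "ennreal ((t 0)\<^sup>2) \<le> ennreal (g j) * indicator (A j) x"
          by (simp add: ennreal_leI)
      qed
      also have "\<dots> \<le> F x" by (rule partial) simp
      finally show False using m r t[of 0] by (simp add: ennreal_le_iff)
    qed
    then show ?thesis by simp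
  next
    case MInf
    then show ?thesis using cramer_nonneg[of x] by simp
  qed
  \<comment> \<open>Bernoulli gives j + 2 \<le> 20(11/10)^j, so the cubic polynomial factor costs
    20^3 (1331/1000)^j, still beaten by 2^-j; 24576000 = 3 * 32^2 * 20^3.\<close>
  define b where "b j = 24576000 * L\<^sup>2 * (1331 / 2000) ^ j" for j :: nat
  have gb: "g j * prob (A j) \<le> b j" for j
  proof -
    have "1 + real j * (1 / 10) \<le> (1 + 1 / 10) ^ j"
      by (rule Bernoulli_inequality) simp
    then have j2: "real j + 2 \<le> 20 * (11 / 10) ^ j" by simp
    have "g j * prob (A j) \<le> g j * (3 * (real j + 1) * (1 / 2) ^ j)"
      by (intro mult_left_mono pA) (simp add: g_def)
    also have "\<dots> = 3072 * L\<^sup>2 * (1 / 2) ^ j * ((real j + 2)\<^sup>2 * (real j + 1))"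
    proof -
      have "t (Suc j) = 32 * L * (real j + 2)" by (simp add: t_def)
      then show ?thesis by (simp only: g_def power_mult_distrib) simp
    qed
    also have "\<dots> \<le> 3072 * L\<^sup>2 * (1 / 2) ^ j * ((20 * (11 / 10) ^ j)\<^sup>2 * (20 * (11 / 10) ^ j))"
      using j2 by (intro mult_left_mono mult_mono power_mono) auto
    also have "\<dots> = 24576000 * L\<^sup>2 * ((1 / 2) ^ j * (((11 / 10) ^ j) ^ 3))"
      by (simp add: power2_eq_square power3_eq_cube)
    also have "(1 / 2) ^ j * (((11 / 10) ^ j) ^ 3) = ((1 / 2) * (11 / 10) ^ 3 :: real) ^ j"
      by (simp only: power_mult_distrib power_mult[symmetric] mult.commute)
    also have "(1 / 2) * (11 / 10) ^ 3 = (1331 / 2000 :: real)"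
      by (simp add: power3_eq_cube)
    finally show ?thesis by (simp add: b_def)
  qed
  have b_sums: "b sums (24576000 * L\<^sup>2 * (1 / (1 - 1331 / 2000)))"
    unfolding b_def by (intro sums_mult geometric_sums) auto
  have "(\<integral>\<^sup>+x. (e2ennreal \<bar>cramer_transform n \<mu> x\<bar>)\<^sup>2 \<partial>\<mu>) \<le> (\<integral>\<^sup>+x. F x \<partial>\<mu>)"
    by (rule nn_integral_mono) (rule pointwise)
  also have "\<dots> = ennreal ((t 0)\<^sup>2) + (\<Sum>j. \<integral>\<^sup>+x. ennreal (g j) * indicator (A j) x \<partial>\<mu>)"
    unfolding F_def using A
    by (subst nn_integral_add, simp, simp, subst nn_integral_suminf) (simp_all add: emeasure_space_1)
  also have "(\<Sum>j. \<integral>\<^sup>+x. ennreal (g j) * indicator (A j) x \<partial>\<mu>) = (\<Sum>j. ennreal (g j * prob (A j)))"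
    using A by (simp add: nn_integral_cmult_indicator emeasure_eq_measure ennreal_mult g_def)
  also have "\<dots> \<le> (\<Sum>j. ennreal (b j))"
    by (intro suminf_le ennreal_leI gb) auto
  also have "\<dots> = ennreal (24576000 * L\<^sup>2 * (1 / (1 - 1331 / 2000)))"
  proof -
    have "(\<Sum>j. ennreal (b j)) = ennreal (\<Sum>j. b j)"
      by (rule suminf_ennreal2) (use sums_summable[OF b_sums] in \<open>auto simp: b_def\<close>)
    then show ?thesis unfolding sums_unique[OF b_sums, symmetric] .
  qed
  also have "ennreal ((t 0)\<^sup>2) + \<dots> = ennreal ((t 0)\<^sup>2 + 24576000 * L\<^sup>2 * (1 / (1 - 1331 / 2000)))"
    by (rule ennreal_plus[symmetric]) auto
  \<comment> \<open>The coefficient of L^2 is about 7.35 * 10^7, below 10000^2.\<close>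
  also have "\<dots> \<le> ennreal ((10000 * L)\<^sup>2)"
    by (intro ennreal_leI) (simp add: t_def power_mult_distrib)
  finally show ?thesis by (simp add: L_def add_left_mono)
qed

end

section \<open>From the second moment to the uniform L2 bound\<close>

theorem theorem1p2:
  "\<exists>c::real. c > 0 \<and>
     (\<forall>(n::nat) (\<mu>::(nat \<Rightarrow> real) measure).
        n \<ge> 2 \<longrightarrow> borel_prob n \<mu> \<longrightarrow> log_concave_measure n \<mu> \<longrightarrow> centered_measure n \<mu> \<longrightarrow>
        L2_norm_ereal \<mu> (cramer_transform n \<mu>) \<le> ennreal (c * real n * ln (real n)))"
proof (intro exI[of _ 10000] conjI allI impI)
  fix n :: nat and \<mu> :: "(nat \<Rightarrow> real) measure"
  assume n: "2 \<le> n" and bp: "borel_prob n \<mu>" and "log_concave_measure n \<mu>" "centered_measure n \<mu>"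
  then interpret centered_log_concave_prob \<mu> n
    unfolding centered_log_concave_prob_def log_concave_prob_def log_concave_prob_axioms_def
      centered_log_concave_prob_axioms_def borel_prob_def by simp
  obtain u where u: "orthonormal n u" "\<forall>\<xi>. \<exists>c. \<forall>z. Rn_inner n \<xi> z = (\<Sum>i<n. c i * Rn_inner n (u i) z)"
    using orthonormal_basis by (elim exE conjE)
  interpret orthonormal_frame \<mu> n u
    by unfold_locales (use u n in auto)
  define I where "I = (\<integral>\<^sup>+x. (e2ennreal \<bar>cramer_transform n \<mu> x\<bar>)\<^sup>2 \<partial>\<mu>)"
  define B where "B = 10000 * (real n * ln (real n))"
  have I: "I \<le> ennreal (B\<^sup>2)"
    unfolding I_def B_def by (rule nn_integral_cramer_sq_le[OF n])
  have "0 \<le> B" using n by (simp add: B_def)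
  \<comment> \<open>The bound makes \<open>I\<close> finite, so \<open>ennreal_sqrt\<close> takes
    its real branch.\<close>
  then obtain r where r: "I = ennreal r" "0 \<le> r" "r \<le> B\<^sup>2"
    using I by (cases I) (auto simp: top_unique)
  have "L2_norm_ereal \<mu> (cramer_transform n \<mu>) = ennreal (sqrt r)"
    unfolding L2_norm_ereal_def I_def[symmetric] by (simp add: ennreal_sqrt_def r)
  also have "\<dots> \<le> ennreal B"
    using r \<open>0 \<le> B\<close> by (intro ennreal_leI real_le_lsqrt) auto
  finally show "L2_norm_ereal \<mu> (cramer_transform n \<mu>) \<le> ennreal (10000 * real n * ln (real n))"
    by (simp add: B_def mult.assoc)
qed simp

end
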